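(* Let $\mathbb{P}$ be a solution of the martingale problem for $\mathcal{A}$, let $h\in C_c^2(E)$, $H := e^h - 1$, and $D_t := e^{h(X_t)-h(X_0)}\exp\big(-\int_0^t \frac{\mathcal{A}H(X_s)}{e^{h(X_s)}}ds\big)$. Let $\mathbb{Q}$ be a probability measure on $(\Omega,\mathcal{F}^X)$ such that $\mathbb{Q}[A] = \mathbb{E}_{\mathbb{P}}[D_t\mathbb{1}_A]$ for all $A\in\mathcal{F}_{t+}^X$ and all $t\ge0$. Then $\mathbb{Q}$ is a solution of the martingale problem for the operator $\tilde{\mathcal{A}}: C_c^2(E)\to B(E)$ given by $\tilde{\mathcal{A}}f := \mathcal{A}f + \frac{\Gamma(H,f)}{e^h}$, and this operator equals $\tilde{\mathcal{A}}f(x) = \frac12\sum_{i,j}\alpha_{ij}(x)\partial_{ij}f(x)+\sum_i\tilde\beta_i(x)\partial_if(x)-\tilde\gamma(x)f(x)+\int_{\mathbb{R}^d}(f(x+\xi)-f(x)-\langle\nabla f(x),\chi(\xi)\rangle)\tilde\mu(x,d\xi)$ with $\tilde\beta(x) = \beta(x)+\alpha(x)\nabla h(x)+\int(e^{h(x+\xi)-h(x)}-1)\chi(\xi)\mu(x,d\xi)$, $\tilde\gamma(x) = e^{-h(x)}\gamma(x)$, $\tilde\mu(x,d\xi) = e^{h(x+\xi)-h(x)}\mu(x,d\xi)$.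
   Context: $E$ is a closed subset of $\mathbb{R}^d$, $E_\Delta = E\cup\{\Delta\}$ its one-point compactification; every measurable function $f$ on $E$ is extended by $f(\Delta):=0$. $\Omega$ is the space of càdlàg $\omega:\mathbb{R}_+\to E_\Delta$ such that $\omega(t-)=\Delta$ or $\omega(t)=\Delta$ implies $\omega(s)=\Delta$ for $s\ge t$; $X_t(\omega)=\omega(t)$, $\mathcal{F}^X=\sigma(X_s:s\ge0)$, $\mathcal{F}_t^X=\sigma(X_s:s\le t)$. $B(E)$ denotes bounded measurable functions on $E$. Fix a bounded continuous $\chi:\mathbb{R}^d\to\mathbb{R}^d$ with $\chi(\xi)=\xi$ near $0$. Let $\alpha,\beta,\gamma$ be measurable maps on $E$ with values in positive semidefinite symmetric $d\times d$ matrices, $\mathbb{R}^d$, $\mathbb{R}_+$, and $\mu$ a transition kernel from $E$ to $\mathbb{R}^d$, such that $\alpha,\beta,\gamma$ and $\int(\|\xi\|^2\wedge1)\mu(\cdot,d\xi)$ are bounded on compact subsets of $E$. For $f\in C_c^2(E)$, $\mathcal{A}f(x)=\frac12\sum_{i,j}\alpha_{ij}(x)\partial_{ij}f(x)+\sum_i\beta_i(x)\partial_if(x)-\gamma(x)f(x)+\int_{\mathbb{R}^d}(f(x+\xi)-f(x)-\langle\nabla f(x),\chi(\xi)\rangle)\mu(x,d\xi)$. For an operator $\mathcal{B}:C_c^2(E)\to B(E)$, a probability measure $\mathbb{P}$ on $(\Omega,\mathcal{F}^X)$ solves the martingale problem for $\mathcal{B}$ if for every $f\in C_c^2(E)$,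 $f(X_t)-f(X_0)-\int_0^t\mathcal{B}f(X_s)ds$ is a $\mathbb{P}$-martingale w.r.t. $(\mathcal{F}_t^X)$. The carré-du-champ operator is $\Gamma(f,g) := \mathcal{A}(fg)-f\mathcal{A}g-g\mathcal{A}f$ for $f,g\in C_c^2(E)$. (Such a $\mathbb{Q}$ exists; $D$ is a strictly positive $((\mathcal{F}_{t+}^X),\mathbb{P})$-martingale.) *)

theory Defs
  imports "HOL-Analysis.Analysis" "HOL-Probability.Probability"
begin

text \<open>Points of R^d are vectors real^'n ('n a finite index type, d = CARD('n)).
  The cemetery point Delta is None; a point x of E is Some x.
  One-point (Alexandroff) compactification of E: U is open iff its trace on E is
  open in E and, if U contains Delta, the complement in E of that trace is compact.\<close>

definition onept_topology :: "(real^'n) set \<Rightarrow> (real^'n) option topology" where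
  "onept_topology E = topology (\<lambda>U. U \<subseteq> insert None (Some ` E)
      \<and> openin (top_of_set E) (Some -` U)
      \<and> (None \<in> U \<longrightarrow> compact (E - Some -` U)))"

definition borel_Delta :: "(real^'n) set \<Rightarrow> (real^'n) option measure" where
  "borel_Delta E = sigma (topspace (onept_topology E)) {U. openin (onept_topology E) U}"

definition extD :: "(real^'n \<Rightarrow> real) \<Rightarrow> (real^'n) option \<Rightarrow> real" where
  "extD f = case_option 0 f"

text \<open>Path space Omega: cadlag paths from R_+ into E_Delta, absorbed at Delta after
  Delta is hit or approached from the left.  Paths are functions on the reals, normalised
  by the value Delta on negative times (which is irrelevant).\<close>
definition Omega :: "(real^'n) set \<Rightarrow> (real \<Rightarrow> (real^'n) option) set" where
  "Omega E = {\<omega>. (\<forall>t. \<omega> t \<in> topspace (onept_topology E))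
      \<and> (\<forall>t<0. \<omega> t = None)
      \<and> (\<forall>t\<ge>0. limitin (onept_topology E) \<omega> (\<omega> t) (at_right t))
      \<and> (\<forall>t>0. \<exists>l. limitin (onept_topology E) \<omega> l (at_left t))
      \<and> (\<forall>t\<ge>0. \<omega> t = None \<longrightarrow> (\<forall>s\<ge>t. \<omega> s = None))
      \<and> (\<forall>t>0. limitin (onept_topology E) \<omega> None (at_left t) \<longrightarrow> (\<forall>s\<ge>t. \<omega> s = None))}"

definition FX :: "(real^'n) set \<Rightarrow> (real \<Rightarrow> (real^'n) option) measure" where
  "FX E = sigma (Omega E)
     {(\<lambda>\<omega>. \<omega> s) -` B \<inter> Omega E | s B. 0 \<le> s \<and> B \<in> sets (borel_Delta E)}"

definition FXt :: "(real^'n) set \<Rightarrow> real \<Rightarrow> (real \<Rightarrow> (real^'n) option) measure" where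
  "FXt E t = sigma (Omega E)
     {(\<lambda>\<omega>. \<omega> s) -` B \<inter> Omega E | s B. 0 \<le> s \<and> s \<le> t \<and> B \<in> sets (borel_Delta E)}"

definition FXtplus :: "(real^'n) set \<Rightarrow> real \<Rightarrow> (real \<Rightarrow> (real^'n) option) set set" where
  "FXtplus E t = (\<Inter>u\<in>{t<..}. sets (FXt E u))"

definition is_martingale ::
  "'a measure \<Rightarrow> (real \<Rightarrow> 'a measure) \<Rightarrow> (real \<Rightarrow> 'a \<Rightarrow> real) \<Rightarrow> bool" where
  "is_martingale P F M \<longleftrightarrow>
     (\<forall>t\<ge>0. integrable P (M t) \<and> M t \<in> borel_measurable (F t))
     \<and> (\<forall>s t. 0 \<le> s \<longrightarrow> s \<le> t \<longrightarrow>
          (\<forall>A\<in>sets (F s). set_lebesgue_integral P A (M t) = set_lebesgue_integral P A (M s)))"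

definition pd :: "'n::finite \<Rightarrow> (real^'n \<Rightarrow> real) \<Rightarrow> real^'n \<Rightarrow> real" where
  "pd i f x = frechet_derivative f (at x) (axis i 1)"

definition grad :: "(real^'n::finite \<Rightarrow> real) \<Rightarrow> real^'n \<Rightarrow> real^'n" where
  "grad f x = (\<chi> i. pd i f x)"

text \<open>C_c^2(E): restrictions to E of C^2 functions with compact support on R^d;
  we work with such extensions f : R^d -> R (evaluated only on E, and at x + xi).\<close>
definition C2c :: "(real^'n::finite \<Rightarrow> real) set" where
  "C2c = {f. (\<forall>x. f differentiable at x) \<and> (\<forall>i x. pd i f differentiable at x)
             \<and> (\<forall>i j. continuous_on UNIV (pd i (pd j f)))
             \<and> compact (closure {x. f x \<noteq> 0})}"

definition gen_op ::
  "(real^'n \<Rightarrow> real^'n^'n) \<Rightarrow> (real^'n \<Rightarrow> real^'n) \<Rightarrow> (real^'n \<Rightarrow> real)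
   \<Rightarrow> (real^'n \<Rightarrow> (real^'n) measure) \<Rightarrow> (real^'n \<Rightarrow> real^'n)
   \<Rightarrow> (real^'n::finite \<Rightarrow> real) \<Rightarrow> real^'n \<Rightarrow> real" where
  "gen_op \<alpha> \<beta> \<gamma> \<mu> \<chi>' f x =
     (1/2) * (\<Sum>i\<in>UNIV. \<Sum>j\<in>UNIV. \<alpha> x $ i $ j * pd i (pd j f) x)
     + (\<Sum>i\<in>UNIV. \<beta> x $ i * pd i f x)
     - \<gamma> x * f x
     + (\<integral>\<xi>. f (x + \<xi>) - f x - inner (grad f x) (\<chi>' \<xi>) \<partial>\<mu> x)"

definition carre ::
  "(('a \<Rightarrow> real) \<Rightarrow> 'a \<Rightarrow> real) \<Rightarrow> ('a \<Rightarrow> real) \<Rightarrow> ('a \<Rightarrow> real) \<Rightarrow> 'a \<Rightarrow> real" where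
  "carre A f g x = A (\<lambda>y. f y * g y) x - f x * A g x - g x * A f x"

definition solves_mp ::
  "(real^'n::finite) set \<Rightarrow> ((real^'n \<Rightarrow> real) \<Rightarrow> real^'n \<Rightarrow> real)
   \<Rightarrow> (real \<Rightarrow> (real^'n) option) measure \<Rightarrow> bool" where
  "solves_mp E B P \<longleftrightarrow>
     prob_space P \<and> space P = Omega E \<and> sets P = sets (FX E)
     \<and> (\<forall>f\<in>C2c. bounded (B f ` E) \<and> B f \<in> borel_measurable (restrict_space borel E))
     \<and> (\<forall>f\<in>C2c. is_martingale P (FXt E)
           (\<lambda>t \<omega>. extD f (\<omega> t) - extD f (\<omega> 0)
                   - set_lebesgue_integral lborel {0..t} (\<lambda>s. extD (B f) (\<omega> s))))"

definition Dproc ::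
  "((real^'n \<Rightarrow> real) \<Rightarrow> real^'n \<Rightarrow> real) \<Rightarrow> (real^'n::finite \<Rightarrow> real)
   \<Rightarrow> real \<Rightarrow> (real \<Rightarrow> (real^'n) option) \<Rightarrow> real" where
  "Dproc A h t \<omega> =
     exp (extD h (\<omega> t) - extD h (\<omega> 0))
     * exp (- set_lebesgue_integral lborel {0..t}
                (\<lambda>s. extD (\<lambda>x. A (\<lambda>y. exp (h y) - 1) x / exp (h x)) (\<omega> s)))"

end

theory Submission
  imports Defs
begin

text \<open>Put \<open>G = e\<^sup>h = 1 + H\<close> and \<open>c = - \<A>H / G\<close>, so that \<open>D\<^sub>t = G(X\<^sub>t) / G(X\<^sub>0) * exp (\<integral>\<^sub>0\<^sup>t c(X\<^sub>r) dr)\<close>.  Since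
  \<open>f G = f + f H\<close> is again in \<open>C2c\<close>, the process \<open>f(X\<^sub>t) G(X\<^sub>t) - \<integral>\<^sub>0\<^sup>t \<A>(f G)(X\<^sub>r) dr\<close> is a martingale
  under \<open>P\<close>.  Multiplying by the exponential factor, the product rule turns the drift into
  \<open>\<A>(f G) + c f G = \<A>(f G) - f \<A>H\<close>, which is \<open>G\<close> times the new operator applied to \<open>f\<close>.  Moving the
  density to \<open>Q\<close> time by time (Fubini) gives the martingale property under \<open>Q\<close>; the explicit form of
  the operator is the computation of the carre-du-champ of \<open>gen_op\<close>.\<close>

section \<open>The compactified state space and the filtration\<close>

text \<open>The functions \<open>e^h\<close> and 1 do not have compact support, so they are not test
  functions; this is why \<open>D\<close> is built from H, whose extension by 0 at the cemetery
  matches e^h = 1 there. Since h and the exponent's integrand are bounded, \<open>D\<close> is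
  bounded on bounded time intervals, and every functional that is integrated is bounded at fixed
  times. The obstacle is regularity in time: c(X_r) is merely measurable in r and the paths jump, so
  the product rule cannot come from differentiating along paths. It is proved in expectation, as an
  error estimate on short intervals. Its time integrand under \<open>P\<close> contains the
  exponential up to time r, which also varies with r; integrability in r is therefore obtained under
  \<open>Q\<close>, where the same number is the expectation of the new drift at time r. Fubini
  requires joint measurability of the path in \<omega> and r with respect to the information up to a
  fixed time, although \<open>FXt\<close> is generated by single coordinates. This is what right
  continuity is used for.\<close>

lemma istopology_onept:
  "istopology (\<lambda>U. U \<subseteq> insert None (Some ` E)
      \<and> openin (top_of_set E) (Some -` U)
      \<and> (None \<in> U \<longrightarrow> compact (E - Some -` U)))"
  unfolding istopology_def
proof (intro conjI allI impI, goal_cases)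
  case (1 S T) then show ?case by blast
next
  case (2 S T)
  then show ?case by (simp add: openin_Int)
next
  case (3 S T)
  then have "E - Some -` (S \<inter> T) = (E - Some -` S) \<union> (E - Some -` T)" by auto
  with 3 show ?case by (simp add: compact_Un)
next
  case (4 \<K>) then show ?case by blast
next
  case (5 \<K>) then show ?case by (auto simp: vimage_Union)
next
  case (6 \<K>)
  then obtain U where U: "U \<in> \<K>" "None \<in> U" by blast
  then have "compact (E - Some -` U)" using 6 by blast
  moreover have "openin (top_of_set E) (Some -` \<Union>\<K>)"
    using 6 by (auto simp: vimage_Union)
  then obtain T where T: "open T" "Some -` \<Union>\<K> = E \<inter> T" by (auto simp: openin_open)
  \<comment> \<open>One member of the family containing \<open>None\<close> suffices: the complement
    of the union is a closed part of its compact complement.\<close>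
  have "E - Some -` \<Union>\<K> = (E - Some -` U) \<inter> - T" using T U by auto
  ultimately show ?case using T by (auto intro: compact_Int_closed)
qed

lemma openin_onept:
  "openin (onept_topology E) U \<longleftrightarrow> U \<subseteq> insert None (Some ` E)
      \<and> openin (top_of_set E) (Some -` U)
      \<and> (None \<in> U \<longrightarrow> compact (E - Some -` U))"
  unfolding onept_topology_def by (subst topology_inverse'[OF istopology_onept]) rule

lemma topspace_onept: "topspace (onept_topology E) = insert None (Some ` E)"
proof -
  have *: "Some -` insert None (Some ` E) = E" by auto
  have "openin (onept_topology E) (insert None (Some ` E))"
    unfolding openin_onept * by simp
  moreover have "topspace (onept_topology E) \<subseteq> insert None (Some ` E)"
    unfolding topspace_def by (auto simp: openin_onept)
  ultimately show ?thesis by (metis openin_subset subset_antisym)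
qed

lemma space_borel_Delta: "space (borel_Delta E) = insert None (Some ` E)"
  unfolding borel_Delta_def by (simp add: topspace_onept space_measure_of_conv)

lemma sets_borel_Delta_openin: "openin (onept_topology E) U \<Longrightarrow> U \<in> sets (borel_Delta E)"
  unfolding borel_Delta_def
  by (subst sets_measure_of) (auto dest: openin_subset)

lemma openin_onept_image:
  assumes "openin (top_of_set E) U"
  shows "openin (onept_topology E) (Some ` U)"
  unfolding openin_onept using assms openin_imp_subset[OF assms]
  by (auto simp: inj_vimage_image_eq)

text \<open>The copy of E is open in the compactification. Carrying the intersection with E through
  the induction turns complements into differences inside that copy.\<close>

lemma Some_image_borel_Delta:
  assumes "C \<in> sets (restrict_space borel E)"
  shows "Some ` C \<in> sets (borel_Delta E)"
proof -
  from assms obtain B where B: "B \<in> sets borel" "C = E \<inter> B" by (auto simp: sets_restrict_space)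
  have E: "Some ` E \<in> sets (borel_Delta E)"
    by (intro sets_borel_Delta_openin openin_onept_image) simp
  from B(1) have "Some ` (E \<inter> B) \<in> sets (borel_Delta E)"
    unfolding sets_borel
  proof (induction rule: sigma_sets.induct)
    case (Basic a)
    then show ?case by (intro sets_borel_Delta_openin openin_onept_image) auto
  next
    case Empty then show ?case by simp
  next
    case (Compl a)
    have "Some ` (E \<inter> (UNIV - a)) = Some ` E - Some ` (E \<inter> a)" by auto
    with Compl E show ?case by auto
  next
    case (Union a)
    have "Some ` (E \<inter> (\<Union> (range a))) = (\<Union>i. Some ` (E \<inter> a i))" by auto
    with Union show ?case by auto
  qed
  with B show ?thesis by simp
qed

lemma extD_simps [simp]: "extD f None = 0" "extD f (Some x) = f x"
  by (simp_all add: extD_def)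

text \<open>The cemetery is a measurable atom, being the complement of the open copy of E, so the
  default value 0 there costs at most one extra measurable point in each preimage.\<close>

lemma measurable_extD:
  assumes "k \<in> borel_measurable (restrict_space borel E)"
  shows "extD k \<in> borel_measurable (borel_Delta E)"
proof (rule measurableI)
  fix B :: "real set" assume B: "B \<in> sets borel"
  have E: "Some ` E \<in> sets (borel_Delta E)"
    by (intro sets_borel_Delta_openin openin_onept_image) simp
  have "k -` B \<inter> E \<in> sets (restrict_space borel E)"
    using measurable_sets[OF assms B] by (simp add: space_restrict_space)
  then have 1: "Some ` (k -` B \<inter> E) \<in> sets (borel_Delta E)" by (rule Some_image_borel_Delta)
  have "space (borel_Delta E) - Some ` E = {None}" by (auto simp: space_borel_Delta)
  then have 2: "{None} \<in> sets (borel_Delta E)" using E by (metis sets.compl_sets)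
  have "extD k -` B \<inter> space (borel_Delta E)
      = Some ` (k -` B \<inter> E) \<union> (if 0 \<in> B then {None} else {})"
    by (auto simp: space_borel_Delta)
  also have "\<dots> \<in> sets (borel_Delta E)" using sets.Un[OF 1 2] 1 by simp
  finally show "extD k -` B \<inter> space (borel_Delta E) \<in> sets (borel_Delta E)" .
qed simp

text \<open>Compact support matters only at the cemetery: if V contains 0, then points mapped
  outside V lie in \<open>K\<close>, so the preimage has compact complement in E.\<close>

lemma continuous_map_extD:
  fixes \<phi> :: "real^'n \<Rightarrow> real"
  assumes E: "closed E" and c: "continuous_on UNIV \<phi>" and K: "compact K" "\<And>x. x \<notin> K \<Longrightarrow> \<phi> x = 0"
  shows "continuous_map (onept_topology E) euclideanreal (extD \<phi>)"
  unfolding continuous_map_def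
proof (intro conjI allI impI)
  show "extD \<phi> \<in> topspace (onept_topology E) \<rightarrow> topspace euclideanreal" by simp
  fix V :: "real set" assume "openin euclideanreal V"
  then have V: "open V" by simp
  let ?U = "{x \<in> topspace (onept_topology E). extD \<phi> x \<in> V}"
  have eq: "Some -` ?U = E \<inter> \<phi> -` V" by (auto simp: topspace_onept)
  have op: "open (\<phi> -` V)" using c V by (simp add: continuous_on_open_vimage)
  show "openin (onept_topology E) ?U"
    unfolding openin_onept eq
  proof (intro conjI impI)
    show "?U \<subseteq> insert None (Some ` E)" by (auto simp: topspace_onept)
    show "openin (top_of_set E) (E \<inter> \<phi> -` V)" using op by auto
    assume "None \<in> ?U"
    then have 0: "0 \<in> V" by simp
    then have "E - E \<inter> \<phi> -` V = K \<inter> (E \<inter> - (\<phi> -` V))" using K(2) by auto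
    then show "compact (E - E \<inter> \<phi> -` V)"
      using K(1) E op by (simp add: closed_Int compact_Int_closed closed_Compl)
  qed
qed

section \<open>Canonical filtration and joint measurability of the path in \<omega> and time\<close>

lemma space_FXt [simp]: "space (FXt E t) = Omega E"
  unfolding FXt_def by (simp add: space_measure_of_conv)

lemma sets_FXt: "sets (FXt E t) = sigma_sets (Omega E)
     {(\<lambda>\<omega>. \<omega> s) -` B \<inter> Omega E | s B. 0 \<le> s \<and> s \<le> t \<and> B \<in> sets (borel_Delta E)}"
  unfolding FXt_def by (rule sets_measure_of) auto

lemma sets_FX: "sets (FX E) = sigma_sets (Omega E)
     {(\<lambda>\<omega>. \<omega> s) -` B \<inter> Omega E | s B. 0 \<le> s \<and> B \<in> sets (borel_Delta E)}"
  unfolding FX_def by (rule sets_measure_of) auto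

lemma sets_FXt_mono: "s \<le> t \<Longrightarrow> sets (FXt E s) \<subseteq> sets (FXt E t)"
  unfolding sets_FXt by (intro sigma_sets_mono') force

lemma sets_FXt_FX: "sets (FXt E s) \<subseteq> sets (FX E)"
  unfolding sets_FXt sets_FX by (intro sigma_sets_mono') force

text \<open>Lets the density hypothesis, given on the right-continuous filtration, be used on the
  filtration in which martingales are tested.\<close>

lemma sets_FXt_subset_plus: "sets (FXt E t) \<subseteq> FXtplus E t"
  unfolding FXtplus_def using sets_FXt_mono[of t _ E] by (auto dest: less_imp_le)

lemma Omega_range: "\<omega> \<in> Omega E \<Longrightarrow> \<omega> t \<in> insert None (Some ` E)"
  unfolding Omega_def topspace_onept by blast

lemma measurable_coordinate:
  assumes "0 \<le> s" "s \<le> t"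
  shows "(\<lambda>\<omega>. \<omega> s) \<in> measurable (FXt E t) (borel_Delta E)"
proof (rule measurableI)
  show "\<omega> s \<in> space (borel_Delta E)" if "\<omega> \<in> space (FXt E t)" for \<omega>
    using that Omega_range[of \<omega> E s] by (simp add: space_borel_Delta)
  show "(\<lambda>\<omega>. \<omega> s) -` B \<inter> space (FXt E t) \<in> sets (FXt E t)" if "B \<in> sets (borel_Delta E)" for B
    unfolding sets_FXt space_FXt using assms that by (intro sigma_sets.Basic) blast
qed

lemma measurable_coordinate_compose:
  assumes "0 \<le> r" "r \<le> t" "k \<in> measurable (borel_Delta E) N"
  shows "(\<lambda>\<omega>. k (\<omega> r)) \<in> measurable (FXt E t) N"
  by (rule measurable_compose[OF measurable_coordinate[OF assms(1,2)] assms(3)])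

lemma measurable_FXt_mono:
  assumes "f \<in> measurable (FXt E s) N" "s \<le> t"
  shows "f \<in> measurable (FXt E t) N"
  by (rule measurable_from_subalg[OF _ assms(1)]) (simp add: subalgebra_def sets_FXt_mono[OF assms(2)])

text \<open>The fraction is the first point of the grid of mesh 1 / \<open>Suc n\<close> strictly to
  the right of x; strictness is needed because \<open>at_right\<close> excludes x. The cap at t
  keeps the sampled time within the horizon, and \<open>x < t\<close> keeps it strictly to the
  right.\<close>

lemma filterlim_floor_right:
  assumes "(x::real) < t"
  shows "filterlim (\<lambda>n. min t ((of_int \<lfloor>real (Suc n) * x\<rfloor> + 1) / real (Suc n))) (at_right x) sequentially"
proof -
  let ?\<sigma> = "\<lambda>n. (of_int \<lfloor>real (Suc n) * x\<rfloor> + 1) / real (Suc n)"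
  have gt: "x < ?\<sigma> n" for n
    by (subst pos_less_divide_eq) (auto simp: mult.commute simp del: of_nat_Suc)
  have le: "?\<sigma> n \<le> x + inverse (real (Suc n))" for n
  proof -
    have "of_int \<lfloor>real (Suc n) * x\<rfloor> + 1 \<le> (x + inverse (real (Suc n))) * real (Suc n)"
      using of_int_floor_le[of "real (Suc n) * x"] by (simp add: algebra_simps del: of_nat_Suc)
    then show ?thesis by (subst pos_divide_le_eq) (auto simp del: of_nat_Suc)
  qed
  have 1: "?\<sigma> \<longlonglongrightarrow> x"
  proof (rule tendsto_sandwich)
    show "(\<lambda>n. x) \<longlonglongrightarrow> x" by simp
    show "(\<lambda>n. x + inverse (real (Suc n))) \<longlonglongrightarrow> x"
      using tendsto_add[OF tendsto_const LIMSEQ_inverse_real_of_nat] by simp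
  qed (auto intro!: always_eventually less_imp_le gt le simp del: of_nat_Suc)
  then have "(\<lambda>n. min t (?\<sigma> n)) \<longlonglongrightarrow> min t x" by (intro tendsto_min tendsto_const)
  then have "(\<lambda>n. min t (?\<sigma> n)) \<longlonglongrightarrow> x" using assms by simp
  moreover have "min t (?\<sigma> n) \<in> {x<..} \<and> min t (?\<sigma> n) \<noteq> x" for n
    using gt[of n] assms unfolding min_def by (auto simp del: of_nat_Suc)
  ultimately show ?thesis
    unfolding filterlim_at by (simp add: always_eventually del: of_nat_Suc greaterThan_iff min_less_iff_conj)
qed

lemma extD_right_limit:
  fixes \<phi> :: "real^'n \<Rightarrow> real"
  assumes "continuous_map (onept_topology E) euclideanreal (extD \<phi>)"
    and "\<omega> \<in> Omega E" "0 \<le> t"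
  shows "((\<lambda>s. extD \<phi> (\<omega> s)) \<longlongrightarrow> extD \<phi> (\<omega> t)) (at_right t)"
proof -
  have "limitin (onept_topology E) \<omega> (\<omega> t) (at_right t)"
    using assms(2,3) unfolding Omega_def by blast
  from continuous_map_limit[OF assms(1) this] show ?thesis by (simp add: o_def)
qed

text \<open>Right continuity only passes to the limit for continuous test functions, hence the detour
  through compactly supported \<open>\<phi>\<close>; the time argument is discretised from the right.\<close>
lemma measurable_path_testfun:
  fixes \<phi> :: "real^'n \<Rightarrow> real"
  assumes E: "closed E" and c: "continuous_on UNIV \<phi>" and K: "compact K" "\<And>x. x \<notin> K \<Longrightarrow> \<phi> x = 0"
    and t: "0 \<le> t"
  shows "(\<lambda>p. extD \<phi> (fst p (max 0 (min t (snd p))))) \<in> borel_measurable (FXt E t \<Otimes>\<^sub>M borel)"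
proof -
  define \<sigma> :: "(real \<Rightarrow> (real^'n) option) \<times> real \<Rightarrow> real" where "\<sigma> p = max 0 (min t (snd p))" for p
  define u where "u n p = extD \<phi> (fst p (min t ((of_int \<lfloor>real (Suc n) * \<sigma> p\<rfloor> + 1) / real (Suc n))))"
    for n and p :: "(real \<Rightarrow> (real^'n) option) \<times> real"
  have \<sigma>: "0 \<le> \<sigma> p" "\<sigma> p \<le> t" for p using t by (auto simp: \<sigma>_def)
  have cm: "continuous_map (onept_topology E) euclideanreal (extD \<phi>)"
    by (rule continuous_map_extD[OF E c K])
  have em: "extD \<phi> \<in> borel_measurable (borel_Delta E)"
    by (intro measurable_extD measurable_restrict_space1 borel_measurable_continuous_onI c)
  have \<sigma>m [measurable]: "\<sigma> \<in> borel_measurable (FXt E t \<Otimes>\<^sub>M borel)"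
    unfolding \<sigma>_def by measurable
  have "(\<lambda>p. extD \<phi> (fst p (\<sigma> p))) \<in> borel_measurable (FXt E t \<Otimes>\<^sub>M borel)"
  proof (rule borel_measurable_LIMSEQ_real[where u=u])
    fix p assume "p \<in> space (FXt E t \<Otimes>\<^sub>M (borel :: real measure))"
    then have p: "fst p \<in> Omega E" by (auto simp: space_pair_measure)
    show "(\<lambda>n. u n p) \<longlonglongrightarrow> extD \<phi> (fst p (\<sigma> p))"
    proof (cases "\<sigma> p = t")
      \<comment> \<open>At the horizon the cap makes the sequence constant: approximating t from the
        right would look at times that \<open>FXt E t\<close> does not see.\<close>
      case True
      have "min t ((of_int \<lfloor>real (Suc n) * \<sigma> p\<rfloor> + 1) / real (Suc n)) = t" for n
      proof -
        have "t \<le> (of_int \<lfloor>real (Suc n) * t\<rfloor> + 1) / real (Suc n)"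
          using real_of_int_floor_add_one_ge[of "real (Suc n) * t"]
          by (subst pos_le_divide_eq) (auto simp: mult.commute simp del: of_nat_Suc)
        then show ?thesis using True by simp
      qed
      then show ?thesis unfolding u_def using True by simp
    next
      case False
      then have "\<sigma> p < t" using \<sigma>[of p] by simp
      from filterlim_compose[OF extD_right_limit[OF cm p \<sigma>(1)] filterlim_floor_right[OF this]]
      show ?thesis unfolding u_def by simp
    qed
  next
    fix n
    have pos: "0 \<le> (of_int \<lfloor>real (Suc n) * \<sigma> p\<rfloor> + 1) / real (Suc n)" for p
      using \<sigma>(1)[of p] by (intro divide_nonneg_nonneg add_nonneg_nonneg) auto
    \<comment> \<open>The discretised time takes only countably many values, indexed by the integer
      i. The extra \<open>max 0\<close> makes the coordinate admissible for negative i as well, and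
      changes nothing at the i that occur.\<close>
    have "(\<lambda>p. extD \<phi> (fst p (min t (max 0 ((of_int i + 1) / real (Suc n))))))
        \<in> borel_measurable (FXt E t \<Otimes>\<^sub>M (borel :: real measure))" for i :: int
      by (intro measurable_compose[OF measurable_fst measurable_coordinate_compose] em) (use t in auto)
    then have "(\<lambda>p. extD \<phi> (fst p (min t (max 0 ((of_int \<lfloor>real (Suc n) * \<sigma> p\<rfloor> + 1) / real (Suc n))))))
        \<in> borel_measurable (FXt E t \<Otimes>\<^sub>M (borel :: real measure))"
      by (rule measurable_compose_countable) measurable
    then show "u n \<in> borel_measurable (FXt E t \<Otimes>\<^sub>M borel)"
      unfolding u_def[abs_def] using pos by (simp add: max_absorb2)
  qed
  then show ?thesis unfolding \<sigma>_def .
qed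

text \<open>Clamping the time to [0,t] makes evaluation measurable on the whole time axis using
  \<open>FXt E t\<close> only. The test functions give preimages of relatively open subsets of E;
  the cemetery is handled as the complement of E.\<close>

lemma measurable_path:
  fixes E :: "(real^'n) set"
  assumes E: "closed E" and t: "0 \<le> t"
  shows "(\<lambda>p. fst p (max 0 (min t (snd p)))) \<in> measurable (FXt E t \<Otimes>\<^sub>M borel) (borel_Delta E)"
proof -
  define Y :: "(real \<Rightarrow> (real^'n) option) \<times> real \<Rightarrow> (real^'n) option"
    where "Y p = fst p (max 0 (min t (snd p)))" for p
  let ?M = "FXt E t \<Otimes>\<^sub>M (borel :: real measure)"
  have Yr: "Y p \<in> insert None (Some ` E)" if "p \<in> space ?M" for p
    using Omega_range[of "fst p" E "max 0 (min t (snd p))"] that by (auto simp: Y_def space_pair_measure)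
  have op: "Y -` (Some ` (E \<inter> U)) \<inter> space ?M \<in> sets ?M" if U: "open U" for U
  proof -
    txt \<open>\<open>\<phi> n\<close> is a continuous function with compact support that is positive exactly on
      \<open>U \<inter> ball 0 n\<close>.\<close>
    define C where "C n = - (U \<inter> ball 0 (real n))" for n
    define \<phi> where "\<phi> n x = infdist x (C n)" for n x
    have C: "closed (C n)" "C n \<noteq> {}" for n
    proof -
      show "closed (C n)" unfolding C_def using U by auto
      show "C n \<noteq> {}"
      proof
        assume "C n = {}"
        then have "UNIV \<subseteq> ball (0::real^'n) (real n)" by (auto simp: C_def)
        then have "bounded (UNIV :: (real^'n) set)" using bounded_ball bounded_subset by blast
        then show False by simp
      qed
    qed
    have pos: "\<phi> n x > 0 \<longleftrightarrow> x \<in> U \<inter> ball 0 (real n)" for n x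
    proof -
      have "\<phi> n x > 0 \<longleftrightarrow> x \<notin> C n"
        unfolding \<phi>_def using in_closed_iff_infdist_zero[OF C] infdist_nonneg[of x "C n"] by (metis less_eq_real_def order_less_irrefl)
      then show ?thesis by (simp add: C_def)
    qed
    have "(\<lambda>p. extD (\<phi> n) (Y p)) \<in> borel_measurable ?M" for n
      unfolding Y_def
    proof (rule measurable_path_testfun[OF E _ compact_cball _ t])
      show "continuous_on UNIV (\<phi> n)" unfolding \<phi>_def by (intro continuous_intros)
      show "\<phi> n x = 0" if "x \<notin> cball 0 (real n)" for x
        unfolding \<phi>_def using that by (intro infdist_zero) (auto simp: C_def)
    qed
    then have "{p \<in> space ?M. 0 < extD (\<phi> n) (Y p)} \<in> sets ?M" for n by measurable
    then have "(\<Union>n. {p \<in> space ?M. 0 < extD (\<phi> n) (Y p)}) \<in> sets ?M" by auto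
    also have "(\<Union>n. {p \<in> space ?M. 0 < extD (\<phi> n) (Y p)}) = Y -` (Some ` (E \<inter> U)) \<inter> space ?M"
    proof -
      have "(\<exists>n. 0 < extD (\<phi> n) y) \<longleftrightarrow> y \<in> Some ` (E \<inter> U)" if y: "y \<in> insert None (Some ` E)" for y
      proof (cases y)
        case None then show ?thesis by auto
      next
        case (Some x)
        obtain n where "norm x < real n" using reals_Archimedean2 by blast
        then show ?thesis using Some y pos by auto
      qed
      from this[OF Yr] show ?thesis by (intro set_eqI) (simp add: conj_commute cong: conj_cong)
    qed
    finally show ?thesis .
  qed
  have "Y \<in> measurable ?M (borel_Delta E)"
    unfolding borel_Delta_def
  proof (rule measurable_measure_of)
    show "{U. openin (onept_topology E) U} \<subseteq> Pow (topspace (onept_topology E))"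
      using openin_subset by auto
    show "Y \<in> space ?M \<rightarrow> topspace (onept_topology E)" using Yr by (auto simp: topspace_onept)
    fix V assume "V \<in> {U. openin (onept_topology E) U}"
    then have V: "V \<subseteq> insert None (Some ` E)" "openin (top_of_set E) (Some -` V)"
      by (auto simp: openin_onept)
    then obtain U where U: "open U" "Some -` V = E \<inter> U" by (auto simp: openin_open)
    \<comment> \<open>An open set is the copy of a relatively open subset of E, up to the single
      point \<open>None\<close>.\<close>
    have VE: "V = Some ` (E \<inter> U) \<union> (V \<inter> {None})"
    proof (rule set_eqI)
      have "Some x \<in> V \<longleftrightarrow> x \<in> E \<inter> U" for x using U(2) by (metis vimage_eq)
      then show "y \<in> V \<longleftrightarrow> y \<in> Some ` (E \<inter> U) \<union> (V \<inter> {None})" for y by (cases y) auto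
    qed
    have N: "Y -` {None} \<inter> space ?M \<in> sets ?M"
    proof -
      have "space ?M - (Y -` (Some ` (E \<inter> UNIV)) \<inter> space ?M) = Y -` {None} \<inter> space ?M"
        using Yr by (intro set_eqI) fastforce
      then show ?thesis using op[OF open_UNIV] by (metis sets.compl_sets)
    qed
    have "Y -` V \<inter> space ?M = (Y -` (Some ` (E \<inter> U)) \<inter> space ?M)
        \<union> (if None \<in> V then Y -` {None} \<inter> space ?M else {})"
      using VE by auto
    also have "\<dots> \<in> sets ?M" using op[OF U(1)] N by simp
    finally show "Y -` V \<inter> space ?M \<in> sets ?M" .
  qed
  then show ?thesis unfolding Y_def .
qed

section \<open>Integrals along paths\<close>

lemma subalgebra_FXt:
  assumes "space P = Omega E" "sets P = sets (FX E)"
  shows "subalgebra P (FXt E t)"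
  using assms sets_FXt_FX[of E t] unfolding subalgebra_def by simp

lemma set_integral_bound_le:
  fixes f :: "real \<Rightarrow> real"
  assumes "u \<le> v" and K: "\<And>r. u \<le> r \<Longrightarrow> r \<le> v \<Longrightarrow> \<bar>f r\<bar> \<le> K"
  shows "\<bar>LINT r:{u..v}|lborel. f r\<bar> \<le> K * (v - u)"
proof -
  have K0: "0 \<le> K" using K[of u] assms(1) by linarith
  have "\<bar>LINT r:{u..v}|lborel. f r\<bar> \<le> (\<integral>r. indicator {u..v} r * K \<partial>lborel)"
  proof (cases "set_integrable lborel {u..v} f")
    case True
    have "norm (\<integral>r. indicator {u..v} r *\<^sub>R f r \<partial>lborel) \<le> (\<integral>r. indicator {u..v} r * K \<partial>lborel)"
    proof (rule Bochner_Integration.integral_norm_bound_integral)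
      show "integrable lborel (\<lambda>r. indicator {u..v} r * K)"
        by (intro integrable_mult_left integrable_real_indicator) (auto simp: emeasure_lborel_Icc_eq)
    qed (use True K in \<open>auto simp: set_integrable_def indicator_def\<close>)
    then show ?thesis by (simp add: set_lebesgue_integral_def)
  next
    \<comment> \<open>The Bochner integral of a non-integrable function is 0 by convention, so the
      bound holds without any measurability of \<open>f\<close>.\<close>
    case False
    then have "(LINT r:{u..v}|lborel. f r) = 0"
      by (simp add: set_lebesgue_integral_def set_integrable_def not_integrable_integral_eq)
    then show ?thesis using K0 assms(1) by simp
  qed
  then show ?thesis using assms(1) by (simp add: mult.commute)
qed

lemma set_integral_combine:
  fixes f :: "real \<Rightarrow> real"
  assumes f: "set_integrable lborel {s..v} f" and "s \<le> u" "u \<le> v"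
  shows "(LINT r:{s..v}|lborel. f r) = (LINT r:{s..u}|lborel. f r) + (LINT r:{u..v}|lborel. f r)"
proof -
  have "{s..v} = {s..u} \<union> {u..v}" using assms by auto
  moreover have "(LINT r:{s..u} \<union> {u..v}|lborel. f r)
      = (LINT r:{s..u}|lborel. f r) + (LINT r:{u..v}|lborel. f r)"
  proof (rule set_integral_Un_AE)
    have "AE r in lborel. r \<noteq> u" by (rule AE_lborel_singleton)
    then show "AE r in lborel. \<not> (r \<in> {s..u} \<and> r \<in> {u..v})" by eventually_elim auto
    show "set_integrable lborel {s..u} f" "set_integrable lborel {u..v} f"
      using assms by (auto intro: set_integrable_subset[OF f])
  qed auto
  ultimately show ?thesis by simp
qed

section \<open>Time integrals of a bounded state function along the path\<close>

context
  fixes E :: "(real^'n) set" and g :: "(real^'n) option \<Rightarrow> real" and K :: real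
  assumes E: "closed E"
    and g: "g \<in> borel_measurable (borel_Delta E)"
    and K: "\<And>y. y \<in> insert None (Some ` E) \<Longrightarrow> \<bar>g y\<bar> \<le> K"
begin

text \<open>Progressive measurability: only times up to v enter, hence the sigma-algebra at time v.
  On the support of the indicator the clamped path is the path itself.\<close>

lemma measurable_path_compose:
  assumes "0 \<le> u"
  shows "(\<lambda>p. indicator {u..v} (snd p) * g (fst p (snd p))) \<in> borel_measurable (FXt E v \<Otimes>\<^sub>M lborel)"
proof (cases "u \<le> v")
  case True
  have "sets (FXt E v \<Otimes>\<^sub>M lborel) = sets (FXt E v \<Otimes>\<^sub>M (borel :: real measure))"
    by (intro sets_pair_measure_cong) simp_all
  then have "(\<lambda>p. fst p (max 0 (min v (snd p)))) \<in> measurable (FXt E v \<Otimes>\<^sub>M lborel) (borel_Delta E)"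
    using measurable_path[OF E, of v] assms True by (simp cong: measurable_cong_sets)
  from measurable_compose[OF this g]
  have "(\<lambda>p. indicator {u..v} (snd p) * g (fst p (max 0 (min v (snd p)))))
      \<in> borel_measurable (FXt E v \<Otimes>\<^sub>M lborel)" by measurable
  also have "(\<lambda>p. indicator {u..v} (snd p) * g (fst p (max 0 (min v (snd p)))))
      = (\<lambda>p. indicator {u..v} (snd p) * g (fst p (snd p)))"
    using assms by (auto simp: fun_eq_iff indicator_def)
  finally show ?thesis .
qed simp

lemma path_set_integrable:
  assumes "\<omega> \<in> Omega E" "0 \<le> u"
  shows "set_integrable lborel {u..v} (\<lambda>r. g (\<omega> r))"
  unfolding set_integrable_def
proof (rule Bochner_Integration.integrable_bound)
  show "integrable lborel (\<lambda>r. indicator {u..v} r *\<^sub>R K)"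
    by (intro integrable_scaleR_left integrable_real_indicator) (auto simp: emeasure_lborel_Icc_eq)
  have "Pair \<omega> \<in> measurable lborel (FXt E v \<Otimes>\<^sub>M lborel)"
    using assms(1) by (intro measurable_Pair1') simp
  from measurable_compose[OF this measurable_path_compose[OF assms(2)]]
  show "(\<lambda>r. indicator {u..v} r *\<^sub>R g (\<omega> r)) \<in> borel_measurable lborel" by simp
  show "AE r in lborel. norm (indicator {u..v} r *\<^sub>R g (\<omega> r)) \<le> norm (indicator {u..v} r *\<^sub>R K)"
    using K[OF Omega_range[OF assms(1)]] by (auto simp: indicator_def intro!: AE_I2 order_trans[OF _ abs_ge_self])
qed

lemma path_integral_measurable:
  assumes "0 \<le> u"
  shows "(\<lambda>\<omega>. LINT r:{u..v}|lborel. g (\<omega> r)) \<in> borel_measurable (FXt E v)"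
  unfolding set_lebesgue_integral_def
  by (rule lborel.borel_measurable_lebesgue_integral)
     (use measurable_path_compose[OF assms] in \<open>simp add: case_prod_beta'\<close>)

lemma path_integral_bound:
  assumes "\<omega> \<in> Omega E" "u \<le> v"
  shows "\<bar>LINT r:{u..v}|lborel. g (\<omega> r)\<bar> \<le> K * (v - u)"
  using assms K[OF Omega_range[OF assms(1)]] by (intro set_integral_bound_le) auto

context
  fixes P :: "(real \<Rightarrow> (real^'n) option) measure" and Z :: "(real \<Rightarrow> (real^'n) option) \<Rightarrow> real" and B :: real
  assumes P: "prob_space P" and spP: "space P = Omega E" and seP: "sets P = sets (FX E)"
    and Z: "Z \<in> borel_measurable P" and B: "\<And>\<omega>. \<omega> \<in> Omega E \<Longrightarrow> \<bar>Z \<omega>\<bar> \<le> B"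
begin

lemma path_Fubini_integrable:
  assumes "0 \<le> u"
  shows "integrable (P \<Otimes>\<^sub>M lborel) (\<lambda>(\<omega>, r). Z \<omega> * (indicator {u..v} r * g (\<omega> r)))"
proof -
  interpret prob_space P by (rule P)
  have K0: "0 \<le> K" using K[of None] by (meson abs_ge_zero insertI1 order_trans)
  \<comment> \<open>Joint measurability is known over the smaller sigma-algebra; the identity map
    transports it to \<open>P\<close>.\<close>
  have "id \<in> measurable P (FXt E v)"
    by (rule measurableI) (use subalgebra_FXt[OF spP seP, of v] in \<open>auto simp: spP subalgebra_def sets.Int_space_eq2\<close>)
  then have "(\<lambda>p. (id (fst p), snd p)) \<in> measurable (P \<Otimes>\<^sub>M lborel) (FXt E v \<Otimes>\<^sub>M lborel)"
    by (intro measurable_Pair measurable_compose[OF measurable_fst] measurable_snd)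
  from measurable_compose[OF this measurable_path_compose[OF assms]]
  have m: "(\<lambda>p. indicator {u..v} (snd p) * g (fst p (snd p))) \<in> borel_measurable (P \<Otimes>\<^sub>M lborel)" by simp
  have mZ: "(\<lambda>p. Z (fst p)) \<in> borel_measurable (P \<Otimes>\<^sub>M lborel)"
    by (rule measurable_compose[OF measurable_fst Z])
  define f where "f p = Z (fst p) * (indicator {u..v} (snd p) * g (fst p (snd p)))" for p
  have fm: "f \<in> borel_measurable (P \<Otimes>\<^sub>M lborel)"
    unfolding f_def[abs_def] using mZ m by measurable
  have "integrable (P \<Otimes>\<^sub>M lborel) (\<lambda>p. indicator (space P \<times> {u..v}) p *\<^sub>R f p)"
  proof (rule integrableI_bounded_set_indicator[where B="B * K"])
    show "space P \<times> {u..v} \<in> sets (P \<Otimes>\<^sub>M lborel)" by auto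
    have "emeasure (P \<Otimes>\<^sub>M lborel) (space P \<times> {u..v}) = emeasure P (space P) * emeasure lborel {u..v}"
      by (rule lborel.emeasure_pair_measure_Times) auto
    also have "\<dots> < \<infinity>" unfolding emeasure_space_1 emeasure_lborel_Icc_eq by (simp split: if_split)
    finally show "emeasure (P \<Otimes>\<^sub>M lborel) (space P \<times> {u..v}) < \<infinity>" .
    show "AE p in P \<Otimes>\<^sub>M lborel. p \<in> space P \<times> {u..v} \<longrightarrow> norm (f p) \<le> B * K"
    proof (rule AE_I2, rule impI)
      fix p assume "p \<in> space P \<times> {u..v}"
      then have p: "fst p \<in> Omega E" unfolding spP by (rule mem_Times_iff[THEN iffD1, THEN conjunct1])
      have "\<bar>indicator {u..v} (snd p) * g (fst p (snd p))\<bar> \<le> K"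
        using K[OF Omega_range[OF p]] K0 by (auto simp: indicator_def)
      then show "norm (f p) \<le> B * K"
        unfolding f_def real_norm_def abs_mult using B[OF p] by (intro mult_mono') auto
    qed
  qed (rule fm)
  then show ?thesis
    by (rule Bochner_Integration.integrable_cong[THEN iffD1, rotated 2])
       (auto simp: f_def space_pair_measure indicator_def split: if_splits)
qed

text \<open>Applied under \<open>P\<close> to the terms of the product rule and under
  \<open>Q\<close> to the new drift. The second claim is the source of integrability in time of such
  expectations; Z has to be the same for all r.\<close>

lemma path_Fubini:
  assumes "0 \<le> u"
  shows "(\<integral>\<omega>. Z \<omega> * (LINT r:{u..v}|lborel. g (\<omega> r)) \<partial>P)
      = (LINT r:{u..v}|lborel. (\<integral>\<omega>. Z \<omega> * g (\<omega> r) \<partial>P))"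
    and "set_integrable lborel {u..v} (\<lambda>r. \<integral>\<omega>. Z \<omega> * g (\<omega> r) \<partial>P)"
proof -
  interpret prob_space P by (rule P)
  interpret pair_sigma_finite P lborel ..
  have *: "(\<integral>\<omega>. Z \<omega> * (indicator {u..v} r * g (\<omega> r)) \<partial>P)
      = indicator {u..v} r *\<^sub>R (\<integral>\<omega>. Z \<omega> * g (\<omega> r) \<partial>P)" for r
    by (cases "r \<in> {u..v}") auto
  show "(\<integral>\<omega>. Z \<omega> * (LINT r:{u..v}|lborel. g (\<omega> r)) \<partial>P)
      = (LINT r:{u..v}|lborel. (\<integral>\<omega>. Z \<omega> * g (\<omega> r) \<partial>P))"
    using Fubini_integral[OF path_Fubini_integrable[OF assms, of v]]
    by (simp add: * set_lebesgue_integral_def)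
  show "set_integrable lborel {u..v} (\<lambda>r. \<integral>\<omega>. Z \<omega> * g (\<omega> r) \<partial>P)"
    using integrable_snd[OF path_Fubini_integrable[OF assms, of v]]
    by (simp add: * set_integrable_def)
qed

end

end

text \<open>\<open>is_martingale\<close> tests against events only. The conditional expectation of M
  t is M s, and a bounded factor known at time s may be pulled out of it; this extends the test to
  all such Z.\<close>

lemma martingale_orthogonal:
  assumes P: "prob_space P" and sub: "\<And>t. 0 \<le> t \<Longrightarrow> subalgebra P (F t)"
    and M: "is_martingale P F M" and t: "0 \<le> s" "s \<le> t"
    and Z: "Z \<in> borel_measurable (F s)" and B: "\<And>\<omega>. \<omega> \<in> space P \<Longrightarrow> \<bar>Z \<omega>\<bar> \<le> B"
  shows "(\<integral>\<omega>. Z \<omega> * M t \<omega> \<partial>P) = (\<integral>\<omega>. Z \<omega> * M s \<omega> \<partial>P)"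
proof -
  interpret prob_space P by (rule P)
  interpret finite_measure_subalgebra P "F s"
    by unfold_locales (use sub t in auto)
  have i: "integrable P (M t)" "integrable P (M s)" "M s \<in> borel_measurable (F s)"
    using M t unfolding is_martingale_def by auto
  have ZP: "Z \<in> borel_measurable P" by (rule measurable_from_subalg[OF subalg Z])
  have iZ: "integrable P (\<lambda>\<omega>. Z \<omega> * M r \<omega>)" if "integrable P (M r)" for r
  proof (rule Bochner_Integration.integrable_bound)
    show "integrable P (\<lambda>\<omega>. B * M r \<omega>)" using that by simp
    show "(\<lambda>\<omega>. Z \<omega> * M r \<omega>) \<in> borel_measurable P" using ZP that by measurable
    show "AE \<omega> in P. norm (Z \<omega> * M r \<omega>) \<le> norm (B * M r \<omega>)"
      by (intro AE_I2) (simp add: abs_mult mult_right_mono order_trans[OF B abs_ge_self])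
  qed
  have "(\<integral>\<omega>\<in>A. M t \<omega> \<partial>P) = (\<integral>\<omega>\<in>A. M s \<omega> \<partial>P)" if "A \<in> sets (F s)" for A
    using M t that unfolding is_martingale_def by blast
  then have ae: "AE \<omega> in P. real_cond_exp P (F s) (M t) \<omega> = M s \<omega>"
    using i by (rule real_cond_exp_charact)
  have "(\<integral>\<omega>. Z \<omega> * M t \<omega> \<partial>P) = (\<integral>\<omega>. Z \<omega> * real_cond_exp P (F s) (M t) \<omega> \<partial>P)"
    using real_cond_exp_intg(2)[OF iZ[OF i(1)] Z] i by simp
  also have "\<dots> = (\<integral>\<omega>. Z \<omega> * M s \<omega> \<partial>P)"
  proof (rule integral_cong_AE)
    show "AE \<omega> in P. Z \<omega> * real_cond_exp P (F s) (M t) \<omega> = Z \<omega> * M s \<omega>"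
      using ae by eventually_elim simp
  qed (use ZP i in measurable)
  finally show ?thesis .
qed

text \<open>Restricted to G, the measure Q is P with density D. Both measures are restricted first
  because the density is only prescribed on G, and the integrals of G-measurable functions survive
  the restriction.\<close>

lemma integral_change_of_measure:
  fixes D F :: "'a \<Rightarrow> real"
  assumes P: "prob_space P" and Q: "prob_space Q" and sub: "subalgebra P G" "subalgebra Q G"
    and D: "D \<in> borel_measurable G" "integrable P D" "\<And>x. x \<in> space P \<Longrightarrow> 0 \<le> D x"
    and PQ: "\<And>A. A \<in> sets G \<Longrightarrow> measure Q A = (\<integral>x. D x * indicator A x \<partial>P)"
    and F: "F \<in> borel_measurable G"
  shows "(\<integral>x. F x \<partial>Q) = (\<integral>x. D x * F x \<partial>P)"
proof -
  interpret P: prob_space P by (rule P)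
  interpret Q: prob_space Q by (rule Q)
  let ?P = "restr_to_subalg P G"
  have DP [measurable]: "D \<in> borel_measurable ?P" by (rule measurable_in_subalg[OF sub(1) D(1)])
  have FP [measurable]: "F \<in> borel_measurable ?P" by (rule measurable_in_subalg[OF sub(1) F])
  have eq: "restr_to_subalg Q G = density ?P (\<lambda>x. ennreal (D x))"
  proof (rule measure_eqI)
    show "sets (restr_to_subalg Q G) = sets (density ?P (\<lambda>x. ennreal (D x)))"
      using sub by (simp add: sets_restr_to_subalg)
    fix A assume "A \<in> sets (restr_to_subalg Q G)"
    then have A: "A \<in> sets G" using sub by (simp add: sets_restr_to_subalg)
    then have AP: "A \<in> sets ?P" "A \<in> sets P" using sub by (auto simp: sets_restr_to_subalg subalgebra_def)
    have "emeasure (restr_to_subalg Q G) A = ennreal (measure Q A)"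
      using A sub by (simp add: emeasure_restr_to_subalg Q.emeasure_eq_measure)
    also have "\<dots> = ennreal (\<integral>x. D x * indicator A x \<partial>P)" using PQ[OF A] by simp
    also have "\<dots> = (\<integral>\<^sup>+x. ennreal (D x * indicator A x) \<partial>P)"
      by (intro nn_integral_eq_integral[symmetric] integrable_real_mult_indicator AP D AE_I2)
         (use D in auto)
    also have "\<dots> = (\<integral>\<^sup>+x. ennreal (D x * indicator A x) \<partial>?P)"
      by (rule nn_integral_subalgebra2[OF sub(1), symmetric]) (use D A in measurable)
    also have "\<dots> = emeasure (density ?P (\<lambda>x. ennreal (D x))) A"
      using AP by (subst emeasure_density) (auto intro!: nn_integral_cong simp: indicator_def)
    finally show "emeasure (restr_to_subalg Q G) A = emeasure (density ?P (\<lambda>x. ennreal (D x))) A" .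
  qed
  have "(\<integral>x. F x \<partial>Q) = (\<integral>x. F x \<partial>restr_to_subalg Q G)"
    by (rule integral_subalgebra2[OF sub(2) F, symmetric])
  also have "\<dots> = (\<integral>x. D x * F x \<partial>?P)"
    unfolding eq by (subst integral_density) (use D in \<open>auto intro!: AE_I2 simp: space_restr_to_subalg\<close>)
  also have "\<dots> = (\<integral>x. D x * F x \<partial>P)"
    by (rule integral_subalgebra2[OF sub(1)]) (use D F in measurable)
  finally show ?thesis .
qed

section \<open>The exponential product rule\<close>

text \<open>Cutting [s,t] into \<open>Suc n\<close> equal pieces bounds the total increment by K (t
  - s)^2 / \<open>Suc n\<close>, which tends to 0. It replaces a derivative-zero argument for a
  function not known to be differentiable beforehand.\<close>

lemma constant_if_quadratic_increments:
  fixes \<phi> :: "real \<Rightarrow> real"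
  assumes "s \<le> t" and K: "\<And>u v. s \<le> u \<Longrightarrow> u \<le> v \<Longrightarrow> v \<le> t \<Longrightarrow> \<bar>\<phi> v - \<phi> u\<bar> \<le> K * (v - u)\<^sup>2"
  shows "\<phi> t = \<phi> s"
proof -
  have *: "\<bar>\<phi> t - \<phi> s\<bar> * real (Suc n) \<le> K * (t - s)\<^sup>2" for n
  proof -
    define d where "d = (t - s) / real (Suc n)"
    define x where "x i = s + real i * d" for i
    have d: "0 \<le> d" "real (Suc n) * d = t - s" using assms(1) by (auto simp: d_def)
    have x: "x 0 = s" "x (Suc n) = t" using d by (auto simp: x_def)
    have "\<bar>\<phi> t - \<phi> s\<bar> = \<bar>\<Sum>i<Suc n. \<phi> (x (Suc i)) - \<phi> (x i)\<bar>"
      using sum_lessThan_telescope[of "\<lambda>i. \<phi> (x i)" "Suc n"] x by simp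
    also have "\<dots> \<le> (\<Sum>i<Suc n. \<bar>\<phi> (x (Suc i)) - \<phi> (x i)\<bar>)" by (rule sum_abs)
    also have "\<dots> \<le> (\<Sum>i<Suc n. K * d\<^sup>2)"
    proof (rule sum_mono)
      fix i assume "i \<in> {..<Suc n}"
      then have "real (Suc i) * d \<le> real (Suc n) * d" using d by (intro mult_right_mono) auto
      then have "x (Suc i) \<le> t" using d by (simp add: x_def)
      moreover have "s \<le> x i" "x i \<le> x (Suc i)" using d(1) by (auto simp: x_def algebra_simps)
      ultimately have "\<bar>\<phi> (x (Suc i)) - \<phi> (x i)\<bar> \<le> K * (x (Suc i) - x i)\<^sup>2" by (intro K)
      then show "\<bar>\<phi> (x (Suc i)) - \<phi> (x i)\<bar> \<le> K * d\<^sup>2" by (simp add: x_def algebra_simps)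
    qed
    also have "\<dots> = real (Suc n) * (K * d\<^sup>2)" by simp
    finally have "\<bar>\<phi> t - \<phi> s\<bar> * real (Suc n) \<le> real (Suc n) * (K * d\<^sup>2) * real (Suc n)"
      by (rule mult_right_mono) simp
    also have "\<dots> = K * (real (Suc n) * d)\<^sup>2" by (simp only: power2_eq_square mult_ac)
    finally show ?thesis unfolding d(2) .
  qed
  show ?thesis
  proof (rule ccontr)
    assume "\<phi> t \<noteq> \<phi> s"
    then have "0 < \<bar>\<phi> t - \<phi> s\<bar>" by simp
    then obtain n where n: "K * (t - s)\<^sup>2 < real n * \<bar>\<phi> t - \<phi> s\<bar>" using reals_Archimedean3 by blast
    have "real n * \<bar>\<phi> t - \<phi> s\<bar> \<le> \<bar>\<phi> t - \<phi> s\<bar> * real (Suc n)"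
      by (simp add: algebra_simps)
    with n *[of n] show False by linarith
  qed
qed

text \<open>Applying 1 + z \<le> e^z to z = x and to z = -x gives x \<le> e^x - 1 \<le> x
  e^x.\<close>

lemma abs_exp_minus_1_le:
  assumes "\<bar>x :: real\<bar> \<le> m"
  shows "\<bar>exp x - 1\<bar> \<le> m * exp m"
proof -
  have "exp x * (1 - x) \<le> exp x * exp (- x)"
    using exp_ge_add_one_self[of "- x"] by (intro mult_left_mono) auto
  then have *: "exp x - 1 \<le> x * exp x" by (simp add: exp_minus algebra_simps)
  have e: "x \<le> exp x - 1" using exp_ge_add_one_self[of x] by linarith
  show ?thesis
  proof (cases "0 \<le> x")
    case True
    then have "x * exp x \<le> m * exp m" using assms by (intro mult_mono) auto
    then show ?thesis using * e True by auto
  next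
    case False
    then have "- x \<le> m * exp m"
      using assms mult_mono[of "- x" m 1 "exp m"] by auto
    then show ?thesis using e False by (auto simp: abs_if)
  qed
qed

text \<open>The same inequality at -x bounds the remainder by x (e^x - 1), and at x shows that it is
  nonnegative; the first-order bound then yields the square.\<close>

lemma abs_exp_remainder_le:
  assumes "\<bar>x :: real\<bar> \<le> m"
  shows "\<bar>exp x - 1 - x\<bar> \<le> m\<^sup>2 * exp m"
proof -
  have "exp x * (1 - x) \<le> exp x * exp (- x)"
    using exp_ge_add_one_self[of "- x"] by (intro mult_left_mono) auto
  then have "exp x - 1 - x \<le> x * (exp x - 1)" by (simp add: exp_minus algebra_simps)
  also have "\<dots> \<le> \<bar>x\<bar> * \<bar>exp x - 1\<bar>" by (simp flip: abs_mult)
  also have "\<dots> \<le> m * (m * exp m)"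
    using assms abs_exp_minus_1_le[OF assms] by (intro mult_mono) auto
  finally have "exp x - 1 - x \<le> m\<^sup>2 * exp m" by (simp add: power2_eq_square mult.assoc)
  moreover have "0 \<le> m\<^sup>2 * exp m" by simp
  ultimately show ?thesis using exp_ge_add_one_self[of x] by linarith
qed

lemma abs_mult_le: "\<bar>a\<bar> \<le> A \<Longrightarrow> \<bar>b\<bar> \<le> B \<Longrightarrow> \<bar>a * b\<bar> \<le> A * (B :: real)"
  unfolding abs_mult by (intro mult_mono') auto

lemma (in prob_space) abs_expectation_le:
  fixes f :: "'a \<Rightarrow> real"
  assumes [measurable]: "f \<in> borel_measurable M" and K: "\<And>x. x \<in> space M \<Longrightarrow> \<bar>f x\<bar> \<le> K"
  shows "\<bar>expectation f\<bar> \<le> K"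
proof -
  have "integrable M f" using K by (intro integrable_const_bound[where B=K] AE_I2) auto
  then have "expectation f \<le> K" "- K \<le> expectation f"
    using K by (auto intro!: integral_le_const integral_ge_const AE_I2 simp: abs_le_iff minus_le_iff)
  then show ?thesis by (simp add: abs_le_iff)
qed

text \<open>Product rule for \<open>y(X\<^sub>t) exp (\<integral> c(X\<^sub>r) dr)\<close>.  No stochastic integration is needed: the
  defect \<open>\<phi>\<close> of the claimed identity has increments of order \<open>(v - u)\<^sup>2\<close>, hence vanishes.\<close>
lemma exponential_product_rule:
  fixes E :: "(real^'n) set" and y a c :: "(real^'n) option \<Rightarrow> real"
  assumes E: "closed E"
    and P: "prob_space P" and spP: "space P = Omega E" and seP: "sets P = sets (FX E)"
    and y: "y \<in> borel_measurable (borel_Delta E)" and Ky: "\<And>p. p \<in> insert None (Some ` E) \<Longrightarrow> \<bar>y p\<bar> \<le> Ky"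
    and a: "a \<in> borel_measurable (borel_Delta E)" and Ka: "\<And>p. p \<in> insert None (Some ` E) \<Longrightarrow> \<bar>a p\<bar> \<le> Ka"
    and c: "c \<in> borel_measurable (borel_Delta E)" and Kc: "\<And>p. p \<in> insert None (Some ` E) \<Longrightarrow> \<bar>c p\<bar> \<le> Kc"
    and mart: "\<And>u v Z B. 0 \<le> u \<Longrightarrow> u \<le> v \<Longrightarrow> Z \<in> borel_measurable (FXt E u)
        \<Longrightarrow> (\<And>\<omega>. \<omega> \<in> Omega E \<Longrightarrow> \<bar>Z \<omega>\<bar> \<le> B)
        \<Longrightarrow> (\<integral>\<omega>. Z \<omega> * (y (\<omega> v) - y (\<omega> u)) \<partial>P) = (\<integral>\<omega>. Z \<omega> * (LINT r:{u..v}|lborel. a (\<omega> r)) \<partial>P)"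
    and st: "0 \<le> s" "s \<le> t"
    and Z0: "Z0 \<in> borel_measurable (FXt E s)" and B: "\<And>\<omega>. \<omega> \<in> Omega E \<Longrightarrow> \<bar>Z0 \<omega>\<bar> \<le> B"
  defines "\<epsilon> \<equiv> \<lambda>r \<omega>. exp (LINT x:{0..r}|lborel. c (\<omega> x))"
  defines "\<psi> \<equiv> \<lambda>r. \<integral>\<omega>. Z0 \<omega> * \<epsilon> r \<omega> * (a (\<omega> r) + c (\<omega> r) * y (\<omega> r)) \<partial>P"
  assumes int: "set_integrable lborel {s..t} \<psi>"
  shows "(\<integral>\<omega>. Z0 \<omega> * \<epsilon> t \<omega> * y (\<omega> t) \<partial>P) = (\<integral>\<omega>. Z0 \<omega> * \<epsilon> s \<omega> * y (\<omega> s) \<partial>P) + (LINT r:{s..t}|lborel. \<psi> r)"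
proof -
  interpret prob_space P by (rule P)
  have sub: "subalgebra P (FXt E r)" for r by (rule subalgebra_FXt[OF spP seP])
  have FP: "f \<in> borel_measurable P" if "f \<in> borel_measurable (FXt E r)" for f :: "_ \<Rightarrow> real" and r
    by (rule measurable_from_subalg[OF sub that])
  have K0: "0 \<le> Ky" "0 \<le> Ka" "0 \<le> Kc"
    using Ky[of None] Ka[of None] Kc[of None] by (auto intro: order_trans[OF abs_ge_zero])
  \<comment> \<open>Bounds \<epsilon> on [0,t], and also \<open>exp (Kc * (v - u))\<close> on every
    subinterval.\<close>
  define L where "L = exp (Kc * t)"
  define J where "J u r \<omega> = (LINT x:{u..r}|lborel. c (\<omega> x))" for u r and \<omega> :: "real \<Rightarrow> (real^'n) option"
  have Jm: "J u r \<in> borel_measurable (FXt E r)" if "0 \<le> u" for u r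
    unfolding J_def by (rule path_integral_measurable[OF E c Kc that])
  have Jb: "\<bar>J u r \<omega>\<bar> \<le> Kc * (r - u)" if "\<omega> \<in> Omega E" "u \<le> r" for u r \<omega>
    unfolding J_def by (rule path_integral_bound[OF E c Kc that])
  have \<epsilon>J: "\<epsilon> r \<omega> = exp (J 0 r \<omega>)" for r \<omega> by (simp add: \<epsilon>_def J_def)
  have \<epsilon>m: "\<epsilon> r \<in> borel_measurable (FXt E r)" for r
    unfolding \<epsilon>J using Jm[of 0 r] by measurable
  have \<epsilon>b: "\<bar>\<epsilon> r \<omega>\<bar> \<le> L" if "\<omega> \<in> Omega E" "0 \<le> r" "r \<le> t" for r \<omega>
  proof -
    have "J 0 r \<omega> \<le> Kc * r" using Jb[OF that(1,2)] by simp
    also have "\<dots> \<le> Kc * t" using that K0 by (intro mult_left_mono) auto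
    finally show ?thesis by (simp add: \<epsilon>J L_def)
  qed
  have \<epsilon>split: "\<epsilon> r \<omega> = \<epsilon> u \<omega> * exp (J u r \<omega>)" if "\<omega> \<in> Omega E" "0 \<le> u" "u \<le> r" for u r \<omega>
    unfolding \<epsilon>J J_def
    using set_integral_combine[OF path_set_integrable[OF E c Kc that(1) order_refl, of r] that(2,3)]
    by (simp add: exp_add)
  define \<phi> where "\<phi> v = (\<integral>\<omega>. Z0 \<omega> * \<epsilon> v \<omega> * y (\<omega> v) \<partial>P) - (LINT r:{s..v}|lborel. \<psi> r)" for v
  \<comment> \<open>One summand for each error of order (v - u)^2: the remainder of the exponential,
    the use of y at time v in place of r, and freezing \<epsilon> at time u.\<close>
  define K where "K = B * L * Ky * (Kc\<^sup>2 * L) + (B * L * Kc * Ka + B * L * (Kc * L * (Ka + Kc * Ky)))"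
  have "\<bar>\<phi> v - \<phi> u\<bar> \<le> K * (v - u)\<^sup>2" if uv: "s \<le> u" "u \<le> v" "v \<le> t" for u v
  proof -
    \<comment> \<open>Everything known at time u is frozen into one bounded test variable, to which
      \<open>mart\<close> applies.\<close>
    define Z where "Z \<omega> = Z0 \<omega> * \<epsilon> u \<omega>" for \<omega>
    have u0: "0 \<le> u" "0 \<le> v" using uv st by auto
    have Zm: "Z \<in> borel_measurable (FXt E u)"
      unfolding Z_def[abs_def] using measurable_FXt_mono[OF Z0 uv(1)] \<epsilon>m[of u] by measurable
    have Zb: "\<bar>Z \<omega>\<bar> \<le> B * L" if "\<omega> \<in> Omega E" for \<omega>
      unfolding Z_def using B \<epsilon>b that u0 uv by (intro abs_mult_le) auto
    note ZP [measurable] = FP[OF Zm]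
    have yP [measurable]: "(\<lambda>\<omega>. y (\<omega> r)) \<in> borel_measurable P" if "0 \<le> r" for r
      using FP[OF measurable_coordinate_compose[OF that order_refl y]] .
    have aP [measurable]: "(\<lambda>\<omega>. a (\<omega> r)) \<in> borel_measurable P" if "0 \<le> r" for r
      using FP[OF measurable_coordinate_compose[OF that order_refl a]] .
    have cP [measurable]: "(\<lambda>\<omega>. c (\<omega> r)) \<in> borel_measurable P" if "0 \<le> r" for r
      using FP[OF measurable_coordinate_compose[OF that order_refl c]] .
    have JP [measurable]: "J u r \<in> borel_measurable P" for r using FP[OF Jm[OF u0(1)]] .
    have Jsmall: "\<bar>J u r \<omega>\<bar> \<le> Kc * (v - u)" if "\<omega> \<in> Omega E" "u \<le> r" "r \<le> v" for r \<omega>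
      using Jb[OF that(1,2)] mult_left_mono[of "r - u" "v - u" Kc] that K0 by auto
    have eL: "exp (Kc * (v - u)) \<le> L"
      unfolding L_def using mult_left_mono[of "v - u" t Kc] uv u0 K0 by simp
    have ib: "integrable P f" if "f \<in> borel_measurable P" "\<And>\<omega>. \<omega> \<in> Omega E \<Longrightarrow> \<bar>f \<omega>\<bar> \<le> b" for f :: "_ \<Rightarrow> real" and b
      using that spP by (intro integrable_const_bound[where B=b] AE_I2) auto
    have yr: "\<bar>y (\<omega> r)\<bar> \<le> Ky" and ar: "\<bar>a (\<omega> r)\<bar> \<le> Ka" and cr: "\<bar>c (\<omega> r)\<bar> \<le> Kc"
      if "\<omega> \<in> Omega E" for \<omega> r
      using Ky Ka Kc Omega_range[OF that] by auto
    have acr: "\<bar>a (\<omega> r) + c (\<omega> r) * y (\<omega> r)\<bar> \<le> Ka + Kc * Ky" if "\<omega> \<in> Omega E" for \<omega> r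
      using ar[OF that, of r] abs_mult_le[OF cr[OF that, of r] yr[OF that, of r]] by linarith
    \<comment> \<open>With this, the exponential over [u,v] is 1 + J + R, where R is of second order
      in v - u.\<close>
    define R where "R \<omega> = exp (J u v \<omega>) - 1 - J u v \<omega>" for \<omega>
    have RP [measurable]: "R \<in> borel_measurable P" unfolding R_def[abs_def] by measurable
    have Rb: "\<bar>R \<omega>\<bar> \<le> Kc\<^sup>2 * L * (v - u)\<^sup>2" if "\<omega> \<in> Omega E" for \<omega>
    proof -
      have "\<bar>R \<omega>\<bar> \<le> (Kc * (v - u))\<^sup>2 * exp (Kc * (v - u))"
        unfolding R_def by (rule abs_exp_remainder_le) (use Jsmall that uv in auto)
      also have "\<dots> \<le> (Kc * (v - u))\<^sup>2 * L" using eL by (intro mult_left_mono) auto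
      finally show ?thesis by (simp add: power_mult_distrib mult_ac)
    qed
    have i1: "integrable P (\<lambda>\<omega>. Z \<omega> * (y (\<omega> v) - y (\<omega> u)))"
    proof (rule ib)
      show "\<bar>Z \<omega> * (y (\<omega> v) - y (\<omega> u))\<bar> \<le> B * L * (Ky + Ky)" if "\<omega> \<in> Omega E" for \<omega>
        using yr[OF that, of u] yr[OF that, of v] by (intro abs_mult_le Zb that) linarith
    qed (use u0 in measurable)
    have i2: "integrable P (\<lambda>\<omega>. Z \<omega> * y (\<omega> v) * J u v \<omega>)"
      by (rule ib[of _ "B * L * Ky * (Kc * (v - u))"])
         (use u0 uv in \<open>measurable, auto intro!: abs_mult_le Zb yr Jsmall\<close>)
    have i3: "integrable P (\<lambda>\<omega>. Z \<omega> * y (\<omega> v) * R \<omega>)"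
      by (rule ib[of _ "B * L * Ky * (Kc\<^sup>2 * L * (v - u)\<^sup>2)"])
         (use u0 uv in \<open>measurable, auto intro!: abs_mult_le Zb yr Rb\<close>)
    have i4: "integrable P (\<lambda>\<omega>. Z \<omega> * y (\<omega> u))"
      by (rule ib[of _ "B * L * Ky"])
         (use u0 uv in \<open>measurable, auto intro!: abs_mult_le Zb yr\<close>)
    \<comment> \<open>Expand the exponential as 1 + J + R and, in the term with 1 only, write y at
      time v as y at time u plus an increment.\<close>
    have "(\<integral>\<omega>. Z0 \<omega> * \<epsilon> v \<omega> * y (\<omega> v) \<partial>P)
        = (\<integral>\<omega>. Z \<omega> * y (\<omega> u) + Z \<omega> * (y (\<omega> v) - y (\<omega> u)) + Z \<omega> * y (\<omega> v) * J u v \<omega> + Z \<omega> * y (\<omega> v) * R \<omega> \<partial>P)"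
      by (rule Bochner_Integration.integral_cong)
         (use \<epsilon>split[OF _ u0(1) uv(2)] spP in \<open>simp_all add: Z_def R_def algebra_simps\<close>)
    also have "\<dots> = (\<integral>\<omega>. Z \<omega> * y (\<omega> u) \<partial>P) + (\<integral>\<omega>. Z \<omega> * (y (\<omega> v) - y (\<omega> u)) \<partial>P)
        + (\<integral>\<omega>. Z \<omega> * y (\<omega> v) * J u v \<omega> \<partial>P) + (\<integral>\<omega>. Z \<omega> * y (\<omega> v) * R \<omega> \<partial>P)"
      using i1 i2 i3 i4 by simp
    finally have expand: "(\<integral>\<omega>. Z0 \<omega> * \<epsilon> v \<omega> * y (\<omega> v) \<partial>P) - (\<integral>\<omega>. Z0 \<omega> * \<epsilon> u \<omega> * y (\<omega> u) \<partial>P)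
        = (\<integral>\<omega>. Z \<omega> * (y (\<omega> v) - y (\<omega> u)) \<partial>P)
        + (\<integral>\<omega>. Z \<omega> * y (\<omega> v) * J u v \<omega> \<partial>P) + (\<integral>\<omega>. Z \<omega> * y (\<omega> v) * R \<omega> \<partial>P)"
      by (simp add: Z_def)
    \<comment> \<open>\<open>A\<close> and \<open>C\<close> are the time densities of the two
      first-order terms. In \<open>C\<close>, y stays at time v because Fubini needs a factor
      independent of r.\<close>
    define A where "A r = (\<integral>\<omega>. Z \<omega> * a (\<omega> r) \<partial>P)" for r
    define C where "C r = (\<integral>\<omega>. Z \<omega> * y (\<omega> v) * c (\<omega> r) \<partial>P)" for r
    have t1: "(\<integral>\<omega>. Z \<omega> * (y (\<omega> v) - y (\<omega> u)) \<partial>P) = (LINT r:{u..v}|lborel. A r)"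
      and Ai: "set_integrable lborel {u..v} A"
      unfolding A_def[abs_def]
      using path_Fubini[OF E a Ka P spP seP ZP Zb u0(1), of v] mart[OF u0(1) uv(2) Zm Zb] by simp_all
    have Zy: "(\<lambda>\<omega>. Z \<omega> * y (\<omega> v)) \<in> borel_measurable P" using u0 by measurable
    have Zyb: "\<bar>Z \<omega> * y (\<omega> v)\<bar> \<le> B * L * Ky" if "\<omega> \<in> Omega E" for \<omega>
      by (intro abs_mult_le Zb yr that)
    have t2: "(\<integral>\<omega>. Z \<omega> * y (\<omega> v) * J u v \<omega> \<partial>P) = (LINT r:{u..v}|lborel. C r)"
      and Ci: "set_integrable lborel {u..v} C"
      unfolding C_def[abs_def] J_def
      using path_Fubini[OF E c Kc P spP seP Zy Zyb u0(1), of v] by simp_all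
    have \<psi>i: "set_integrable lborel {u..v} \<psi>" "set_integrable lborel {s..v} \<psi>"
      using uv by (auto intro: set_integrable_subset[OF int])
    have "\<phi> v - \<phi> u = (\<integral>\<omega>. Z \<omega> * y (\<omega> v) * R \<omega> \<partial>P) + (LINT r:{u..v}|lborel. A r + C r - \<psi> r)"
      unfolding \<phi>_def using expand set_integral_combine[OF \<psi>i(2) uv(1,2)] Ai Ci \<psi>i(1) t1 t2
      by (simp add: set_integral_add set_integral_diff)
    moreover have "\<bar>\<integral>\<omega>. Z \<omega> * y (\<omega> v) * R \<omega> \<partial>P\<bar> \<le> B * L * Ky * (Kc\<^sup>2 * L * (v - u)\<^sup>2)"
      by (rule abs_expectation_le)
         (use u0 uv spP in \<open>measurable, auto intro!: abs_mult_le Zb yr Rb\<close>)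
    \<comment> \<open>The mismatch of the densities is itself of order v - u; integrating over [u,v]
      supplies the second power.\<close>
    moreover have "\<bar>LINT r:{u..v}|lborel. A r + C r - \<psi> r\<bar>
        \<le> (B * L * Kc * (Ka * (v - u)) + B * L * (Kc * (v - u) * L * (Ka + Kc * Ky))) * (v - u)"
    proof (rule set_integral_bound_le[OF uv(2)])
      fix r assume r: "u \<le> r" "r \<le> v"
      then have r0: "0 \<le> r" "r \<le> t" using u0 uv by auto
      have e1: "\<bar>exp (J u r \<omega>) - 1\<bar> \<le> Kc * (v - u) * L" if "\<omega> \<in> Omega E" for \<omega>
      proof -
        have "\<bar>exp (J u r \<omega>) - 1\<bar> \<le> Kc * (v - u) * exp (Kc * (v - u))"
          by (rule abs_exp_minus_1_le[OF Jsmall[OF that r]])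
        also have "\<dots> \<le> Kc * (v - u) * L" using eL K0 uv by (intro mult_left_mono) auto
        finally show ?thesis .
      qed
      have k1: "integrable P (\<lambda>\<omega>. Z \<omega> * a (\<omega> r))"
        by (rule ib[of _ "B * L * Ka"]) (use r0 in \<open>measurable, auto intro!: abs_mult_le Zb ar\<close>)
      have k2: "integrable P (\<lambda>\<omega>. Z \<omega> * y (\<omega> v) * c (\<omega> r))"
        by (rule ib[of _ "B * L * Ky * Kc"]) (use r0 u0 in \<open>measurable, auto intro!: abs_mult_le Zb yr cr\<close>)
      have k2': "integrable P (\<lambda>\<omega>. Z \<omega> * y (\<omega> r) * c (\<omega> r))"
        by (rule ib[of _ "B * L * Ky * Kc"]) (use r0 u0 in \<open>measurable, auto intro!: abs_mult_le Zb yr cr\<close>)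
      have k3: "integrable P (\<lambda>\<omega>. Z \<omega> * ((exp (J u r \<omega>) - 1) * (a (\<omega> r) + c (\<omega> r) * y (\<omega> r))))"
        by (rule ib[of _ "B * L * (Kc * (v - u) * L * (Ka + Kc * Ky))"])
           (use r0 u0 in \<open>measurable, auto intro!: abs_mult_le Zb acr e1\<close>)
      \<comment> \<open>Splitting \<epsilon> at u isolates the effect of freezing it there, namely
        the factor e^J - 1 in the last summand.\<close>
      have "\<psi> r = (\<integral>\<omega>. Z \<omega> * a (\<omega> r) + Z \<omega> * y (\<omega> r) * c (\<omega> r)
          + Z \<omega> * ((exp (J u r \<omega>) - 1) * (a (\<omega> r) + c (\<omega> r) * y (\<omega> r))) \<partial>P)"
        unfolding \<psi>_def
        by (rule Bochner_Integration.integral_cong)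
           (use \<epsilon>split[OF _ u0(1) r(1)] spP in \<open>simp_all add: Z_def algebra_simps\<close>)
      also have "\<dots> = A r + (\<integral>\<omega>. Z \<omega> * y (\<omega> r) * c (\<omega> r) \<partial>P)
          + (\<integral>\<omega>. Z \<omega> * ((exp (J u r \<omega>) - 1) * (a (\<omega> r) + c (\<omega> r) * y (\<omega> r))) \<partial>P)"
        using k1 k2' k3 by (simp add: A_def)
      finally have "A r + C r - \<psi> r = (C r - (\<integral>\<omega>. Z \<omega> * y (\<omega> r) * c (\<omega> r) \<partial>P))
          - (\<integral>\<omega>. Z \<omega> * ((exp (J u r \<omega>) - 1) * (a (\<omega> r) + c (\<omega> r) * y (\<omega> r))) \<partial>P)" by simp
      moreover have "C r - (\<integral>\<omega>. Z \<omega> * y (\<omega> r) * c (\<omega> r) \<partial>P) = (\<integral>\<omega>. Z \<omega> * c (\<omega> r) * (y (\<omega> v) - y (\<omega> r)) \<partial>P)"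
        unfolding C_def using k2 k2' by (simp add: algebra_simps flip: Bochner_Integration.integral_diff)
      \<comment> \<open>Paths may jump, so the increment of y over [r,v] need not be small pathwise.
        Against a factor known at time r its expectation is, by a second use of
        \<open>mart\<close>.\<close>
      moreover have "\<dots> = (\<integral>\<omega>. Z \<omega> * c (\<omega> r) * (LINT x:{r..v}|lborel. a (\<omega> x)) \<partial>P)"
      proof (rule mart[OF r0(1) r(2)])
        show "(\<lambda>\<omega>. Z \<omega> * c (\<omega> r)) \<in> borel_measurable (FXt E r)"
          using measurable_FXt_mono[OF Zm r(1)] measurable_coordinate_compose[OF r0(1) order_refl c] by measurable
        show "\<bar>Z \<omega> * c (\<omega> r)\<bar> \<le> B * L * Kc" if "\<omega> \<in> Omega E" for \<omega>
          by (intro abs_mult_le Zb cr that)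
      qed
      moreover have "\<bar>\<integral>\<omega>. Z \<omega> * c (\<omega> r) * (LINT x:{r..v}|lborel. a (\<omega> x)) \<partial>P\<bar> \<le> B * L * Kc * (Ka * (v - u))"
      proof (rule abs_expectation_le)
        have [measurable]: "(\<lambda>\<omega>. LINT x:{r..v}|lborel. a (\<omega> x)) \<in> borel_measurable P"
          by (rule FP[OF path_integral_measurable[OF E a Ka r0(1)]])
        show "(\<lambda>\<omega>. Z \<omega> * c (\<omega> r) * (LINT x:{r..v}|lborel. a (\<omega> x))) \<in> borel_measurable P"
          using r0 by measurable
        fix \<omega> assume "\<omega> \<in> space P"
        then have w: "\<omega> \<in> Omega E" using spP by simp
        have "\<bar>LINT x:{r..v}|lborel. a (\<omega> x)\<bar> \<le> Ka * (v - r)"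
          by (rule path_integral_bound[OF E a Ka w r(2)])
        also have "\<dots> \<le> Ka * (v - u)" using r K0 by (intro mult_left_mono) auto
        finally show "\<bar>Z \<omega> * c (\<omega> r) * (LINT x:{r..v}|lborel. a (\<omega> x))\<bar> \<le> B * L * Kc * (Ka * (v - u))"
          by (intro abs_mult_le Zb cr w)
      qed
      moreover have "\<bar>\<integral>\<omega>. Z \<omega> * ((exp (J u r \<omega>) - 1) * (a (\<omega> r) + c (\<omega> r) * y (\<omega> r))) \<partial>P\<bar>
          \<le> B * L * (Kc * (v - u) * L * (Ka + Kc * Ky))"
        by (rule abs_expectation_le)
           (use r0 u0 spP in \<open>measurable, auto intro!: abs_mult_le Zb acr e1\<close>)
      ultimately show "\<bar>A r + C r - \<psi> r\<bar>
          \<le> B * L * Kc * (Ka * (v - u)) + B * L * (Kc * (v - u) * L * (Ka + Kc * Ky))" by linarith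
    qed
    ultimately have "\<bar>\<phi> v - \<phi> u\<bar> \<le> B * L * Ky * (Kc\<^sup>2 * L * (v - u)\<^sup>2)
        + (B * L * Kc * (Ka * (v - u)) + B * L * (Kc * (v - u) * L * (Ka + Kc * Ky))) * (v - u)"
      by linarith
    also have "\<dots> = K * (v - u)\<^sup>2" by (simp add: K_def power2_eq_square algebra_simps)
    finally show ?thesis .
  qed
  from constant_if_quadratic_increments[OF st(2) this] have "\<phi> t = \<phi> s" by simp
  moreover have "(LINT r:{s..s}|lborel. \<psi> r) = 0"
    using set_integral_bound_le[of s s \<psi> "\<bar>\<psi> s\<bar>"] by simp
  ultimately show ?thesis by (simp add: \<phi>_def)
qed

section \<open>Calculus in C2c and the generator\<close>

lemma pd_eqI: "(f has_derivative D) (at x) \<Longrightarrow> pd i f x = D (axis i 1)"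
  unfolding pd_def using frechet_derivative_at by metis

lemma has_derivative_grad:
  fixes f :: "real^'n::finite \<Rightarrow> real"
  assumes "f differentiable at x"
  shows "(f has_derivative (\<lambda>v. grad f x \<bullet> v)) (at x)"
proof -
  let ?D = "frechet_derivative f (at x)"
  have D: "(f has_derivative ?D) (at x)" using assms frechet_derivative_works by blast
  then have lin: "linear ?D" by (rule has_derivative_linear)
  have "?D v = grad f x \<bullet> v" for v
  proof -
    have "?D v = ?D (\<Sum>i\<in>UNIV. (v $ i) *\<^sub>R axis i 1)"
      using basis_expansion[of v] by (simp add: scalar_mult_eq_scaleR)
    also have "\<dots> = (\<Sum>i\<in>UNIV. (v $ i) * ?D (axis i 1))"
      by (simp add: linear_sum[OF lin] linear_scale[OF lin])
    also have "\<dots> = grad f x \<bullet> v"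
      by (simp add: inner_vec_def grad_def pd_def mult.commute)
    finally show ?thesis .
  qed
  then have "?D = (\<lambda>v. grad f x \<bullet> v)" by (rule ext)
  with D show ?thesis by simp
qed

text \<open>\<open>C2c\<close> without the support condition: the factor e^h is C^2 but tends to 1
  away from the support of h.\<close>

definition C2 :: "(real^'n::finite \<Rightarrow> real) \<Rightarrow> bool" where
  "C2 f \<longleftrightarrow> (\<forall>x. f differentiable at x) \<and> (\<forall>i x. pd i f differentiable at x)
     \<and> (\<forall>i j. continuous_on UNIV (pd i (pd j f)))"

lemma C2D:
  assumes "C2 f"
  shows "f differentiable at x" "pd i f differentiable at x" "continuous_on UNIV (pd i (pd j f))"
    "continuous_on UNIV f" "continuous_on UNIV (pd i f)"
proof -
  show 1: "f differentiable at x" "pd i f differentiable at x" "continuous_on UNIV (pd i (pd j f))"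
    for x i j
    using assms unfolding C2_def by auto
  show "continuous_on UNIV f" "continuous_on UNIV (pd i f)"
    using 1 by (auto intro!: continuous_at_imp_continuous_on differentiable_imp_continuous_within)
qed

lemma C2c_iff: "f \<in> C2c \<longleftrightarrow> C2 f \<and> compact (closure {x. f x \<noteq> 0})"
  unfolding C2c_def C2_def by blast

lemma pd_add:
  assumes "f differentiable at x" "g differentiable at x"
  shows "pd i (\<lambda>y. f y + g y) x = pd i f x + pd i g x"
  using has_derivative_add[OF assms[THEN has_derivative_grad]]
  by (subst pd_eqI, assumption) (simp add: grad_def inner_axis)

lemma pd_mult:
  assumes "f differentiable at x" "g differentiable at x"
  shows "pd i (\<lambda>y. f y * g y) x = f x * pd i g x + pd i f x * g x"
  using has_derivative_mult[OF assms[THEN has_derivative_grad]]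
  by (subst pd_eqI, assumption) (simp add: grad_def inner_axis)

lemma pd_exp:
  assumes "f differentiable at x"
  shows "pd i (\<lambda>y. exp (f y)) x = exp (f x) * pd i f x"
  using has_derivative_exp[OF assms[THEN has_derivative_grad]]
  by (subst pd_eqI, assumption) (simp add: grad_def inner_axis)

lemma pd_const: "pd i (\<lambda>y. c) x = 0"
  by (subst pd_eqI[OF has_derivative_const]) simp

lemma C2_const: "C2 (\<lambda>x :: real^'n::finite. c)"
proof -
  have "pd i (\<lambda>x :: real^'n. c) = (\<lambda>x. 0)" for i and c :: real by (rule ext) (rule pd_const)
  then show ?thesis unfolding C2_def by simp
qed

lemma C2_add:
  assumes "C2 f" "C2 g"
  shows "C2 (\<lambda>x. f x + g x)"
proof -
  note d = C2D[OF assms(1)] C2D[OF assms(2)]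
  have 1: "pd i (\<lambda>y. f y + g y) = (\<lambda>x. pd i f x + pd i g x)" for i
    by (rule ext) (simp add: pd_add d)
  have 2: "pd j (\<lambda>x. pd i f x + pd i g x) = (\<lambda>x. pd j (pd i f) x + pd j (pd i g) x)" for i j
    by (rule ext) (simp add: pd_add d)
  show ?thesis unfolding C2_def 1 2 by (auto intro!: derivative_intros continuous_intros d)
qed

lemma pd_pd_mult:
  assumes "C2 f" "C2 g"
  shows "pd j (pd i (\<lambda>x. f x * g x)) x
    = f x * pd j (pd i g) x + pd j f x * pd i g x + pd i f x * pd j g x + pd j (pd i f) x * g x"
proof -
  note d = C2D[OF assms(1)] C2D[OF assms(2)]
  have "pd i (\<lambda>y. f y * g y) = (\<lambda>x. f x * pd i g x + pd i f x * g x)"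
    by (rule ext) (simp add: pd_mult d)
  then show ?thesis by (simp add: pd_add pd_mult d)
qed

lemma C2_mult:
  assumes "C2 f" "C2 g"
  shows "C2 (\<lambda>x. f x * g x)"
proof -
  note d = C2D[OF assms(1)] C2D[OF assms(2)]
  have 1: "pd i (\<lambda>y. f y * g y) = (\<lambda>x. f x * pd i g x + pd i f x * g x)" for i
    by (rule ext) (simp add: pd_mult d)
  have 2: "pd j (pd i (\<lambda>x. f x * g x))
      = (\<lambda>x. f x * pd j (pd i g) x + pd j f x * pd i g x + pd i f x * pd j g x + pd j (pd i f) x * g x)" for i j
    by (rule ext) (rule pd_pd_mult[OF assms])
  have "\<forall>i x. pd i (\<lambda>y. f y * g y) differentiable at x"
    unfolding 1 by (auto intro!: derivative_intros d)
  then show ?thesis unfolding C2_def 2 by (auto intro!: derivative_intros continuous_intros d)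
qed

lemma C2_exp:
  assumes "C2 f"
  shows "C2 (\<lambda>x. exp (f x))"
proof -
  note d = C2D[OF assms]
  have e: "(\<lambda>y. exp (f y)) differentiable at x" for x
    using has_derivative_exp[OF has_derivative_grad[OF d(1)]] by (rule differentiableI)
  have 1: "pd i (\<lambda>y. exp (f y)) = (\<lambda>x. exp (f x) * pd i f x)" for i
    by (rule ext) (simp add: pd_exp d)
  have 2: "pd j (\<lambda>x. exp (f x) * pd i f x) = (\<lambda>x. exp (f x) * pd j (pd i f) x + exp (f x) * pd j f x * pd i f x)" for i j
    by (rule ext) (simp add: pd_mult pd_exp e d)
  show ?thesis unfolding C2_def 1 2 by (auto intro!: derivative_intros continuous_intros d e)
qed

section \<open>Compact supports and uniform bounds for test functions\<close>

lemma compact_support_subset: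
  fixes f g :: "real^'n::finite \<Rightarrow> real"
  assumes "compact (closure {x. f x \<noteq> 0})" "\<And>x. g x \<noteq> 0 \<Longrightarrow> f x \<noteq> 0"
  shows "compact (closure {x. g x \<noteq> 0})"
proof -
  have "closure {x. g x \<noteq> 0} \<subseteq> closure {x. f x \<noteq> 0}" using assms(2) by (intro closure_mono) auto
  then show ?thesis using assms(1) by (metis closed_closure compact_Int_closed inf.absorb2)
qed

lemma C2c_mult_C2:
  assumes "f \<in> C2c" "C2 g"
  shows "(\<lambda>x. f x * g x) \<in> C2c"
  unfolding C2c_iff
proof
  show "C2 (\<lambda>x. f x * g x)" using assms by (simp add: C2c_iff C2_mult)
  show "compact (closure {x. f x * g x \<noteq> 0})"
    by (rule compact_support_subset[of f]) (use assms in \<open>auto simp: C2c_iff simp del: compact_closure\<close>)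
qed

text \<open>Subtracting 1 restores compact support, because e^h - 1 vanishes wherever h
  does.\<close>

lemma C2c_exp_minus_1:
  assumes "h \<in> C2c" shows "(\<lambda>x. exp (h x) - 1) \<in> C2c"
  using C2_add[OF C2_exp C2_const[of "-1"], of h] assms
  unfolding C2c_iff by (auto intro: compact_support_subset[of h] simp del: compact_closure)

lemma pd_zero_outside_support:
  assumes "x \<notin> closure {x. f x \<noteq> 0}"
  shows "pd i f x = 0"
proof -
  have "(f has_derivative (\<lambda>v. 0)) (at x)"
  proof (rule has_derivative_transform_within_open[where s="- closure {x. f x \<noteq> 0}"])
    show "((\<lambda>x. 0) has_derivative (\<lambda>v. 0)) (at x)" by simp
    show "0 = f y" if "y \<in> - closure {x. f x \<noteq> 0}" for y
      using that closure_subset[of "{x. f x \<noteq> 0}"] by auto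
  qed (use assms in auto)
  then show ?thesis by (rule pd_eqI)
qed

lemma bounded_if_compact_support:
  fixes f :: "real^'n::finite \<Rightarrow> real"
  assumes "continuous_on UNIV f" "compact S" "\<And>x. x \<notin> S \<Longrightarrow> f x = 0"
  obtains K where "0 < K" "\<And>x. \<bar>f x\<bar> \<le> K"
proof -
  have "bounded (f ` S)"
    using assms by (intro compact_imp_bounded compact_continuous_image continuous_on_subset[OF assms(1)]) auto
  then obtain K where K: "K > 0" "\<And>x. x \<in> S \<Longrightarrow> \<bar>f x\<bar> \<le> K"
    unfolding bounded_pos by auto
  have "\<bar>f x\<bar> \<le> K" for x using K assms(3)[of x] by (cases "x \<in> S") auto
  with K(1) show thesis by (rule that)
qed

lemma C2c_bounds:
  fixes f :: "real^'n::finite \<Rightarrow> real"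
  assumes "f \<in> C2c"
  obtains K where "0 < K" "\<And>x. \<bar>f x\<bar> \<le> K" "\<And>x i. \<bar>pd i f x\<bar> \<le> K" "\<And>x i j. \<bar>pd i (pd j f) x\<bar> \<le> K"
proof -
  let ?S = "closure {x. f x \<noteq> 0}"
  have f: "C2 f" "compact ?S" using assms by (auto simp: C2c_iff)
  note d = C2D[OF f(1)]
  have z0: "f x = 0" if "x \<notin> ?S" for x using that closure_subset[of "{x. f x \<noteq> 0}"] by auto
  have z1: "pd i f x = 0" if "x \<notin> ?S" for x i using that by (rule pd_zero_outside_support)
  have z2: "pd j (pd i f) x = 0" if "x \<notin> ?S" for x i j
  proof (rule pd_zero_outside_support)
    \<comment> \<open>The support of a first derivative lies in the closed support of f, so the
      locality of \<open>pd\<close> can be used a second time.\<close>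
    have "closure {x. pd i f x \<noteq> 0} \<subseteq> ?S" using z1 by (intro closure_minimal) auto
    then show "x \<notin> closure {x. pd i f x \<noteq> 0}" using that by auto
  qed
  obtain K0 where K0: "0 < K0" "\<And>x. \<bar>f x\<bar> \<le> K0"
    using bounded_if_compact_support[OF d(4) f(2) z0] by blast
  have "\<exists>K. 0 < K \<and> (\<forall>x. \<bar>pd i f x\<bar> \<le> K)" for i
    using bounded_if_compact_support[OF d(5) f(2) z1] by metis
  then obtain K1 where K1: "\<And>i. 0 < K1 i" "\<And>i x. \<bar>pd i f x\<bar> \<le> K1 i" by metis
  have "\<exists>K. 0 < K \<and> (\<forall>x. \<bar>pd i (pd j f) x\<bar> \<le> K)" for i j
    using bounded_if_compact_support[OF d(3) f(2) z2] by metis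
  then obtain K2 where K2: "\<And>i j. 0 < K2 i j" "\<And>i j x. \<bar>pd i (pd j f) x\<bar> \<le> K2 i j" by metis
  \<comment> \<open>A sum of nonnegative bounds over finitely many indices dominates each of them,
    giving one constant for all derivatives.\<close>
  define K where "K = K0 + (\<Sum>i\<in>UNIV. K1 i) + (\<Sum>i\<in>UNIV. \<Sum>j\<in>UNIV. K2 i j)"
  have n1: "0 \<le> (\<Sum>i\<in>UNIV. K1 i)" and n2: "0 \<le> (\<Sum>i\<in>UNIV. \<Sum>j\<in>UNIV. K2 i j)"
    by (intro sum_nonneg less_imp_le[OF K1(1)] less_imp_le[OF K2(1)])+
  have s1: "K1 i \<le> (\<Sum>i\<in>UNIV. K1 i)" for i
    using K1(1) by (intro member_le_sum) (auto intro: less_imp_le)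
  have s2: "K2 i j \<le> (\<Sum>i\<in>UNIV. \<Sum>j\<in>UNIV. K2 i j)" for i j
  proof -
    have "K2 i j \<le> (\<Sum>j\<in>UNIV. K2 i j)"
      using K2(1) by (intro member_le_sum) (auto intro: less_imp_le)
    also have "\<dots> \<le> (\<Sum>i\<in>UNIV. \<Sum>j\<in>UNIV. K2 i j)"
      using K2(1) by (intro member_le_sum[where f="\<lambda>i. \<Sum>j\<in>UNIV. K2 i j"]) (auto intro!: sum_nonneg intro: less_imp_le)
    finally show ?thesis .
  qed
  show thesis
  proof (rule that)
    show "0 < K" using K0(1) n1 n2 by (simp add: K_def)
    show "\<bar>f x\<bar> \<le> K" for x using K0(2)[of x] n1 n2 by (simp add: K_def)
    show "\<bar>pd i f x\<bar> \<le> K" for x i using K1(2)[of i x] s1[of i] K0(1) n2 by (simp add: K_def)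
    show "\<bar>pd i (pd j f) x\<bar> \<le> K" for x i j
      using K2(2)[of i j x] s2[of i j] K0(1) n1 by (simp add: K_def)
  qed
qed

text \<open>Mean value inequality; the dimension enters by bounding the Euclidean norm of the
  gradient by its l1 norm.\<close>

lemma Lipschitz_if_bounded_pd:
  fixes f :: "real^'n::finite \<Rightarrow> real"
  assumes d: "\<And>x. f differentiable at x" and K: "\<And>x i. \<bar>pd i f x\<bar> \<le> K"
  shows "\<bar>f y - f x\<bar> \<le> real CARD('n) * K * norm (y - x)"
proof -
  have "norm (f y - f x) \<le> real CARD('n) * K * norm (y - x)"
  proof (rule differentiable_bound[OF convex_UNIV])
    show "(f has_derivative (\<lambda>v. grad f z \<bullet> v)) (at z within UNIV)" for z
      using has_derivative_grad[OF d] by simp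
    show "onorm (\<lambda>v. grad f z \<bullet> v) \<le> real CARD('n) * K" for z
    proof (rule onorm_le)
      fix v :: "real^'n"
      have "norm (grad f z) \<le> (\<Sum>i\<in>UNIV. \<bar>grad f z $ i\<bar>)" by (rule norm_le_l1_cart)
      also have "\<dots> \<le> real CARD('n) * K"
        using sum_bounded_above[of UNIV "\<lambda>i. \<bar>grad f z $ i\<bar>" K] K by (simp add: grad_def)
      finally have "norm (grad f z) * norm v \<le> real CARD('n) * K * norm v"
        by (rule mult_right_mono) simp
      then show "norm (grad f z \<bullet> v) \<le> real CARD('n) * K * norm v"
        using Cauchy_Schwarz_ineq2[of "grad f z" v] by simp
    qed
  qed auto
  then show ?thesis by simp
qed

text \<open>For the second-order bound, the mean value inequality is applied to f minus its linear
  part at x, on the ball of radius |\<xi>|: there its gradient is of order |\<xi>|, since the first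
  partial derivatives are Lipschitz. The square of the dimension comes from two l1 estimates. The
  constant is uniform in x and \<xi>.\<close>

lemma C2c_Taylor:
  fixes f :: "real^'n::finite \<Rightarrow> real"
  assumes "f \<in> C2c"
  obtains K where "0 < K" "\<And>x. \<bar>f x\<bar> \<le> K" "\<And>x. norm (grad f x) \<le> K"
    "\<And>x \<xi>. \<bar>f (x + \<xi>) - f x\<bar> \<le> K * norm \<xi>"
    "\<And>x \<xi>. \<bar>f (x + \<xi>) - f x - grad f x \<bullet> \<xi>\<bar> \<le> K * (norm \<xi>)\<^sup>2"
proof -
  obtain K where K: "0 < K" "\<And>x. \<bar>f x\<bar> \<le> K" "\<And>x i. \<bar>pd i f x\<bar> \<le> K" "\<And>x i j. \<bar>pd i (pd j f) x\<bar> \<le> K"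
    using C2c_bounds[OF assms] by blast
  have "C2 f" using assms by (simp add: C2c_iff)
  note d = C2D[OF this]
  let ?N = "real CARD('n)"
  have N1: "1 \<le> ?N" by simp
  have g: "norm (grad f z - grad f x) \<le> ?N * (?N * K * norm (z - x))" for z x
  proof -
    have "norm (grad f z - grad f x) \<le> (\<Sum>i\<in>UNIV. \<bar>(grad f z - grad f x) $ i\<bar>)" by (rule norm_le_l1_cart)
    also have "\<dots> \<le> ?N * (?N * K * norm (z - x))"
      using sum_bounded_above[of UNIV "\<lambda>i. \<bar>(grad f z - grad f x) $ i\<bar>" "?N * K * norm (z - x)"]
        Lipschitz_if_bounded_pd[OF d(2) K(4)] by (simp add: grad_def)
    finally show ?thesis .
  qed
  have gb: "norm (grad f z) \<le> ?N * K" for z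
  proof -
    have "norm (grad f z) \<le> (\<Sum>i\<in>UNIV. \<bar>grad f z $ i\<bar>)" by (rule norm_le_l1_cart)
    also have "\<dots> \<le> ?N * K"
      using sum_bounded_above[of UNIV "\<lambda>i. \<bar>grad f z $ i\<bar>" K] K by (simp add: grad_def)
    finally show ?thesis .
  qed
  have T: "\<bar>f (x + \<xi>) - f x - grad f x \<bullet> \<xi>\<bar> \<le> ?N * ?N * K * (norm \<xi>)\<^sup>2" for x \<xi>
  proof -
    let ?g = "\<lambda>z. f z - grad f x \<bullet> z"
    have "norm (?g (x + \<xi>) - ?g x) \<le> ?N * (?N * K * norm \<xi>) * norm ((x + \<xi>) - x)"
    proof (rule differentiable_bound[OF convex_cball[of x "norm \<xi>"]])
      fix z assume z: "z \<in> cball x (norm \<xi>)"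
      show "(?g has_derivative (\<lambda>v. grad f z \<bullet> v - grad f x \<bullet> v)) (at z within cball x (norm \<xi>))"
        by (intro derivative_intros has_derivative_at_withinI[OF has_derivative_grad] d)
      have "norm (grad f z - grad f x) \<le> ?N * (?N * K * norm \<xi>)"
        using z K(1) by (intro order_trans[OF g] mult_left_mono) (auto simp: dist_norm norm_minus_commute)
      then show "onorm (\<lambda>v. grad f z \<bullet> v - grad f x \<bullet> v) \<le> ?N * (?N * K * norm \<xi>)"
        unfolding inner_diff_left[symmetric]
        by (intro onorm_le) (auto intro!: order_trans[OF Cauchy_Schwarz_ineq2] mult_right_mono)
    qed (auto simp: dist_norm)
    then show ?thesis by (simp add: inner_add_right power2_eq_square mult_ac algebra_simps)
  qed
  have le: "K \<le> ?N * ?N * K" "?N * K \<le> ?N * ?N * K"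
    using N1 K(1) mult_mono[of 1 ?N 1 ?N] by (auto intro: order_trans)
  show thesis
  proof (rule that[of "?N * ?N * K"])
    show "\<bar>f (x + \<xi>) - f x\<bar> \<le> ?N * ?N * K * norm \<xi>" for x \<xi>
      using Lipschitz_if_bounded_pd[OF d(1) K(3), of "x + \<xi>" x]
        mult_right_mono[OF le(2) norm_ge_zero[of \<xi>]] unfolding add_diff_cancel_left' by linarith
    show "\<bar>f x\<bar> \<le> ?N * ?N * K" "norm (grad f x) \<le> ?N * ?N * K" for x
      using order_trans[OF K(2) le(1)] order_trans[OF gb le(2)] .
  qed (use K T in auto)
qed

lemma C2c_borel: "f \<in> C2c \<Longrightarrow> f \<in> borel_measurable borel"
  by (intro borel_measurable_continuous_onI C2D(4)) (simp add: C2c_iff)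

text \<open>The jump integrand of \<open>gen_op\<close>: the increment of f with its small-jump
  compensator.\<close>

definition comp_incr :: "(real^'n \<Rightarrow> real^'n) \<Rightarrow> (real^'n::finite \<Rightarrow> real) \<Rightarrow> real^'n \<Rightarrow> real^'n \<Rightarrow> real" where
  "comp_incr \<chi>' f x \<xi> = f (x + \<xi>) - f x - grad f x \<bullet> \<chi>' \<xi>"

lemma grad_mult:
  assumes "f differentiable at x" "g differentiable at x"
  shows "grad (\<lambda>y. f y * g y) x = f x *\<^sub>R grad g x + g x *\<^sub>R grad f x"
  by (simp add: vec_eq_iff grad_def pd_mult[OF assms] mult.commute)

lemma grad_add:
  assumes "f differentiable at x" "g differentiable at x"
  shows "grad (\<lambda>y. f y + g y) x = grad f x + grad g x"
  by (simp add: vec_eq_iff grad_def pd_add[OF assms])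

section \<open>Integrability and tilting of jump integrals against a Levy measure\<close>

context
  fixes \<nu> :: "(real^'n::finite) measure" and \<chi>' :: "real^'n \<Rightarrow> real^'n" and C :: real
  assumes se: "sets \<nu> = sets borel"
    and fin: "(\<integral>\<^sup>+\<xi>. ennreal (min ((norm \<xi>)\<^sup>2) 1) \<partial>\<nu>) \<le> ennreal C"
    and chi_cont: "continuous_on UNIV \<chi>'" and chi_bdd: "bounded (range \<chi>')"
    and chi_id: "\<exists>\<epsilon>>0. \<forall>\<xi>. norm \<xi> < \<epsilon> \<longrightarrow> \<chi>' \<xi> = \<xi>"
begin

lemma Levy_integrable:
  fixes F :: "real^'n \<Rightarrow> 'b::{banach,second_countable_topology}"
  assumes F: "F \<in> borel_measurable borel" and e: "0 < e"
    and near: "\<And>\<xi>. norm \<xi> < e \<Longrightarrow> norm (F \<xi>) \<le> K * (norm \<xi>)\<^sup>2" and bd: "\<And>\<xi>. norm (F \<xi>) \<le> L"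
  shows "integrable \<nu> F"
proof (rule Bochner_Integration.integrable_bound)
  let ?m = "\<lambda>\<xi>::real^'n. min ((norm \<xi>)\<^sup>2) 1"
  have m: "integrable \<nu> ?m"
  proof (rule integrableI_bounded)
    show "?m \<in> borel_measurable \<nu>" unfolding measurable_cong_sets[OF se refl] by measurable
    have "(\<integral>\<^sup>+\<xi>. ennreal (norm (?m \<xi>)) \<partial>\<nu>) = (\<integral>\<^sup>+\<xi>. ennreal (?m \<xi>) \<partial>\<nu>)" by simp
    also have "\<dots> < \<infinity>" using fin by (auto simp: less_top[symmetric] top_unique)
    finally show "(\<integral>\<^sup>+\<xi>. ennreal (norm (?m \<xi>)) \<partial>\<nu>) < \<infinity>" .
  qed
  define d where "d = min e 1"
  have d: "0 < d" "d \<le> 1" "d \<le> e" using e by (auto simp: d_def)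
  \<comment> \<open>Near 0 the quadratic bound with K applies, and d \<le> 1 makes the truncated
    square the square itself. Outside the ball of radius d the truncated square is at least d^2, so
    L / d^2 times it dominates L.\<close>
  define M where "M = \<bar>K\<bar> + L / d\<^sup>2"
  have L0: "0 \<le> L" using bd[of 0] norm_ge_zero order_trans by blast
  have M: "0 \<le> M" "K \<le> M" "L / d\<^sup>2 \<le> M"
    using divide_nonneg_nonneg[OF L0 zero_le_power2[of d]] abs_ge_self[of K] abs_ge_zero[of K]
    unfolding M_def by linarith+
  show "integrable \<nu> (\<lambda>\<xi>. M * ?m \<xi>)" using m by simp
  show "F \<in> borel_measurable \<nu>" using F unfolding measurable_cong_sets[OF se refl] .
  have "norm (F \<xi>) \<le> M * ?m \<xi>" for \<xi>
  proof (cases "norm \<xi> < d")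
    case True
    then have "(norm \<xi>)\<^sup>2 \<le> 1" using d by (intro power_le_one) auto
    then have m1: "?m \<xi> = (norm \<xi>)\<^sup>2" by simp
    have "norm (F \<xi>) \<le> K * (norm \<xi>)\<^sup>2" using near True d by auto
    also have "\<dots> \<le> M * (norm \<xi>)\<^sup>2" using M by (intro mult_right_mono) auto
    finally show ?thesis unfolding m1 .
  next
    case False
    then have "d\<^sup>2 \<le> (norm \<xi>)\<^sup>2" using d by (intro power_mono) auto
    moreover have "d\<^sup>2 \<le> 1" using d by (intro power_le_one) auto
    ultimately have m1: "d\<^sup>2 \<le> ?m \<xi>" by simp
    have "norm (F \<xi>) \<le> L / d\<^sup>2 * d\<^sup>2" using bd d by simp
    also have "\<dots> \<le> M * ?m \<xi>" using m1 M by (intro mult_mono) auto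
    finally show ?thesis .
  qed
  then show "AE \<xi> in \<nu>. norm (F \<xi>) \<le> norm (M * ?m \<xi>)"
    by (intro AE_I2 order_trans[OF _ abs_ge_self[of "M * _", folded real_norm_def]])
qed

lemma chi_borel: "\<chi>' \<in> borel_measurable borel"
  by (rule borel_measurable_continuous_onI[OF chi_cont])

lemma shift_borel: "f \<in> C2c \<Longrightarrow> (\<lambda>\<xi>. f (x + \<xi>)) \<in> borel_measurable borel"
  by (rule measurable_compose[OF _ C2c_borel]) auto

text \<open>Near 0 the truncation is the identity, so the integrand is a Taylor remainder of second
  order; elsewhere f, its gradient and \<chi>' are bounded.\<close>

lemma comp_incr_integrable:
  assumes f: "f \<in> C2c"
  shows "integrable \<nu> (comp_incr \<chi>' f x)"
proof -
  obtain K where K: "0 < K" "\<And>x. \<bar>f x\<bar> \<le> K" "\<And>x. norm (grad f x) \<le> K"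
      "\<And>x \<xi>. \<bar>f (x + \<xi>) - f x - grad f x \<bullet> \<xi>\<bar> \<le> K * (norm \<xi>)\<^sup>2"
    using C2c_Taylor[OF f] by metis
  obtain e where e: "0 < e" "\<And>\<xi>. norm \<xi> < e \<Longrightarrow> \<chi>' \<xi> = \<xi>" using chi_id by blast
  obtain X where X: "\<And>\<xi>. norm (\<chi>' \<xi>) \<le> X" using chi_bdd by (auto simp: bounded_iff)
  show ?thesis
  proof (rule Levy_integrable[OF _ e(1)])
    show "comp_incr \<chi>' f x \<in> borel_measurable borel"
      unfolding comp_incr_def[abs_def] using shift_borel[OF f] chi_borel by measurable
    show "norm (comp_incr \<chi>' f x \<xi>) \<le> K * (norm \<xi>)\<^sup>2" if "norm \<xi> < e" for \<xi>
      using K(4)[of x \<xi>] e(2)[OF that] by (simp add: comp_incr_def)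
    show "norm (comp_incr \<chi>' f x \<xi>) \<le> K + K + K * X" for \<xi>
    proof -
      have "\<bar>grad f x \<bullet> \<chi>' \<xi>\<bar> \<le> norm (grad f x) * norm (\<chi>' \<xi>)" by (rule Cauchy_Schwarz_ineq2)
      also have "\<dots> \<le> K * X" using K(1) by (intro mult_mono K X) auto
      finally show ?thesis using K(2)[of x] K(2)[of "x + \<xi>"] by (simp add: comp_incr_def)
    qed
  qed
qed

text \<open>The weight e^(h(x+\<xi>)-h(x)) - 1 equals e^(-h(x)) times an increment of H, a test
  function; it is thus bounded and of order |\<xi>|. The other factor is bounded and of order
  |\<xi>| near 0 too, so the product is quadratic there.\<close>

lemma tilt_chi_integrable:
  assumes h: "h \<in> C2c"
  shows "integrable \<nu> (\<lambda>\<xi>. (exp (h (x + \<xi>) - h x) - 1) *\<^sub>R \<chi>' \<xi>)"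
    and "f \<in> C2c \<Longrightarrow> integrable \<nu> (\<lambda>\<xi>. (exp (h (x + \<xi>) - h x) - 1) * (f (x + \<xi>) - f x))"
proof -
  let ?H = "\<lambda>x. exp (h x) - 1"
  have H: "?H \<in> C2c" by (rule C2c_exp_minus_1[OF h])
  have w: "exp (h (x + \<xi>) - h x) - 1 = exp (- h x) * (?H (x + \<xi>) - ?H x)" for \<xi>
    by (simp add: exp_diff exp_minus field_simps)
  obtain K where K: "0 < K" "\<And>x. \<bar>?H x\<bar> \<le> K" "\<And>x \<xi>. \<bar>?H (x + \<xi>) - ?H x\<bar> \<le> K * norm \<xi>"
    using C2c_Taylor[OF H] by metis
  obtain e where e: "0 < e" "\<And>\<xi>. norm \<xi> < e \<Longrightarrow> \<chi>' \<xi> = \<xi>" using chi_id by blast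
  obtain X where X: "\<And>\<xi>. norm (\<chi>' \<xi>) \<le> X" using chi_bdd by (auto simp: bounded_iff)
  have wb: "(\<lambda>\<xi>. exp (h (x + \<xi>) - h x) - 1) \<in> borel_measurable borel"
    using shift_borel[OF h] by measurable
  have w1: "\<bar>exp (h (x + \<xi>) - h x) - 1\<bar> \<le> exp (- h x) * (K * norm \<xi>)" for \<xi>
    unfolding w using K(3)[of x \<xi>] by (simp add: abs_mult)
  have w2: "\<bar>exp (h (x + \<xi>) - h x) - 1\<bar> \<le> exp (- h x) * (K + K)" for \<xi>
    unfolding w using K(2)[of x] K(2)[of "x + \<xi>"] unfolding abs_mult by (intro mult_mono) auto
  show "integrable \<nu> (\<lambda>\<xi>. (exp (h (x + \<xi>) - h x) - 1) *\<^sub>R \<chi>' \<xi>)"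
  proof (rule Levy_integrable[OF _ e(1)])
    show "(\<lambda>\<xi>. (exp (h (x + \<xi>) - h x) - 1) *\<^sub>R \<chi>' \<xi>) \<in> borel_measurable borel"
      using wb chi_borel by measurable
    show "norm ((exp (h (x + \<xi>) - h x) - 1) *\<^sub>R \<chi>' \<xi>) \<le> exp (- h x) * K * (norm \<xi>)\<^sup>2" if "norm \<xi> < e" for \<xi>
      using mult_right_mono[OF w1[of \<xi>], of "norm \<xi>"] e(2)[OF that]
      by (simp add: power2_eq_square mult_ac)
    show "norm ((exp (h (x + \<xi>) - h x) - 1) *\<^sub>R \<chi>' \<xi>) \<le> exp (- h x) * (K + K) * X" for \<xi>
      unfolding norm_scaleR by (rule mult_mono'[OF w2 X]) auto
  qed
  assume f: "f \<in> C2c"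
  obtain M where M: "0 < M" "\<And>x. \<bar>f x\<bar> \<le> M" "\<And>x \<xi>. \<bar>f (x + \<xi>) - f x\<bar> \<le> M * norm \<xi>"
    using C2c_Taylor[OF f] by metis
  show "integrable \<nu> (\<lambda>\<xi>. (exp (h (x + \<xi>) - h x) - 1) * (f (x + \<xi>) - f x))"
  proof (rule Levy_integrable[OF _ e(1)])
    show "(\<lambda>\<xi>. (exp (h (x + \<xi>) - h x) - 1) * (f (x + \<xi>) - f x)) \<in> borel_measurable borel"
      using wb shift_borel[OF f] by measurable
    show "norm ((exp (h (x + \<xi>) - h x) - 1) * (f (x + \<xi>) - f x)) \<le> exp (- h x) * K * M * (norm \<xi>)\<^sup>2" for \<xi>
    proof -
      have "norm ((exp (h (x + \<xi>) - h x) - 1) * (f (x + \<xi>) - f x)) \<le> exp (- h x) * (K * norm \<xi>) * (M * norm \<xi>)"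
        unfolding real_norm_def abs_mult by (rule mult_mono'[OF w1 M(3)]) auto
      then show ?thesis by (simp add: power2_eq_square mult_ac)
    qed
    show "norm ((exp (h (x + \<xi>) - h x) - 1) * (f (x + \<xi>) - f x)) \<le> exp (- h x) * (K + K) * (M + M)" for \<xi>
    proof -
      have "\<bar>f (x + \<xi>) - f x\<bar> \<le> M + M" using M(2)[of x] M(2)[of "x + \<xi>"] by linarith
      then show ?thesis unfolding real_norm_def abs_mult by (intro mult_mono'[OF w2]) auto
    qed
  qed
qed

text \<open>Rewriting the jump part with the tilted measure costs a change of the compensator,
  which is what the integral term in \<open>\<tilde>\<beta>\<close> accounts for.\<close>
lemma comp_incr_tilt:
  assumes h: "h \<in> C2c" and f: "f \<in> C2c"
  shows "(\<integral>\<xi>. comp_incr \<chi>' f x \<xi> \<partial>\<nu>) + (\<integral>\<xi>. (exp (h (x + \<xi>) - h x) - 1) * (f (x + \<xi>) - f x) \<partial>\<nu>)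
    = (\<integral>\<xi>. comp_incr \<chi>' f x \<xi> \<partial>density \<nu> (\<lambda>\<xi>. ennreal (exp (h (x + \<xi>) - h x))))
      + grad f x \<bullet> (\<integral>\<xi>. (exp (h (x + \<xi>) - h x) - 1) *\<^sub>R \<chi>' \<xi> \<partial>\<nu>)"
proof -
  let ?w = "\<lambda>\<xi>. exp (h (x + \<xi>) - h x)"
  note ic = comp_incr_integrable[OF f, of x]
  note iv = tilt_chi_integrable(1)[OF h, of x]
  note ip = tilt_chi_integrable(2)[OF h f, of x]
  have wm: "?w \<in> borel_measurable \<nu>"
    using shift_borel[OF h] unfolding measurable_cong_sets[OF se refl] by measurable
  have "(\<integral>\<xi>. comp_incr \<chi>' f x \<xi> \<partial>density \<nu> (\<lambda>\<xi>. ennreal (?w \<xi>))) = (\<integral>\<xi>. ?w \<xi> * comp_incr \<chi>' f x \<xi> \<partial>\<nu>)"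
    by (rule integral_real_density) (use ic wm in auto)
  \<comment> \<open>Write the weight w as 1 + (w - 1), and the compensated increment in the second
    part as increment minus compensator. Each of the three pieces is integrable on its own.\<close>
  also have "\<dots> = (\<integral>\<xi>. comp_incr \<chi>' f x \<xi> + (?w \<xi> - 1) * (f (x + \<xi>) - f x) - grad f x \<bullet> ((?w \<xi> - 1) *\<^sub>R \<chi>' \<xi>) \<partial>\<nu>)"
    by (rule Bochner_Integration.integral_cong) (auto simp: comp_incr_def algebra_simps)
  also have "\<dots> = (\<integral>\<xi>. comp_incr \<chi>' f x \<xi> \<partial>\<nu>) + (\<integral>\<xi>. (?w \<xi> - 1) * (f (x + \<xi>) - f x) \<partial>\<nu>)
      - (\<integral>\<xi>. grad f x \<bullet> ((?w \<xi> - 1) *\<^sub>R \<chi>' \<xi>) \<partial>\<nu>)"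
    using ic ip integrable_inner_right[OF iv] by (simp del: inner_scaleR_right)
  also have "(\<integral>\<xi>. grad f x \<bullet> ((?w \<xi> - 1) *\<^sub>R \<chi>' \<xi>) \<partial>\<nu>) = grad f x \<bullet> (\<integral>\<xi>. (?w \<xi> - 1) *\<^sub>R \<chi>' \<xi> \<partial>\<nu>)"
    by (rule integral_inner_right[OF iv])
  finally show ?thesis by simp
qed

end

lemma gen_op_comp_incr:
  "gen_op \<alpha> \<beta> \<gamma> \<mu> \<chi>' f x = (1/2) * (\<Sum>i\<in>UNIV. \<Sum>j\<in>UNIV. \<alpha> x $ i $ j * pd i (pd j f) x)
     + \<beta> x \<bullet> grad f x - \<gamma> x * f x + (\<integral>\<xi>. comp_incr \<chi>' f x \<xi> \<partial>\<mu> x)"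
  unfolding gen_op_def comp_incr_def by (simp add: inner_vec_def grad_def)

section \<open>Algebra of the generator at a fixed state\<close>

context
  fixes \<alpha> :: "real^'n::finite \<Rightarrow> real^'n^'n" and \<beta> :: "real^'n \<Rightarrow> real^'n" and \<gamma> :: "real^'n \<Rightarrow> real"
    and \<mu> :: "real^'n \<Rightarrow> (real^'n) measure" and \<chi>' :: "real^'n \<Rightarrow> real^'n" and x :: "real^'n" and C :: real
  assumes se: "sets (\<mu> x) = sets borel"
    and fin: "(\<integral>\<^sup>+\<xi>. ennreal (min ((norm \<xi>)\<^sup>2) 1) \<partial>\<mu> x) \<le> ennreal C"
    and chi: "continuous_on UNIV \<chi>'" "bounded (range \<chi>')" "\<exists>\<epsilon>>0. \<forall>\<xi>. norm \<xi> < \<epsilon> \<longrightarrow> \<chi>' \<xi> = \<xi>"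
begin

text \<open>Needed to evaluate the generator at f e^h = f + H f. Splitting the jump integral relies
  on integrability of each compensated increment.\<close>

lemma gen_op_add:
  assumes f: "f \<in> C2c" and g: "g \<in> C2c"
  shows "gen_op \<alpha> \<beta> \<gamma> \<mu> \<chi>' (\<lambda>y. f y + g y) x = gen_op \<alpha> \<beta> \<gamma> \<mu> \<chi>' f x + gen_op \<alpha> \<beta> \<gamma> \<mu> \<chi>' g x"
proof -
  note df = C2D[of f] and dg = C2D[of g]
  have c: "C2 f" "C2 g" using f g by (auto simp: C2c_iff)
  have "pd j (\<lambda>y. f y + g y) = (\<lambda>y. pd j f y + pd j g y)" for j
    by (rule ext) (simp add: pd_add df dg c)
  then have p: "pd i (pd j (\<lambda>y. f y + g y)) x = pd i (pd j f) x + pd i (pd j g) x" for i j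
    by (simp add: pd_add df dg c)
  have gr: "grad (\<lambda>y. f y + g y) x = grad f x + grad g x" by (simp add: grad_add df dg c)
  have "(\<integral>\<xi>. comp_incr \<chi>' (\<lambda>y. f y + g y) x \<xi> \<partial>\<mu> x) = (\<integral>\<xi>. comp_incr \<chi>' f x \<xi> + comp_incr \<chi>' g x \<xi> \<partial>\<mu> x)"
    by (rule Bochner_Integration.integral_cong) (auto simp: comp_incr_def gr inner_add_left)
  also have "\<dots> = (\<integral>\<xi>. comp_incr \<chi>' f x \<xi> \<partial>\<mu> x) + (\<integral>\<xi>. comp_incr \<chi>' g x \<xi> \<partial>\<mu> x)"
    by (rule Bochner_Integration.integral_add) (rule comp_incr_integrable[OF se fin chi] f g)+
  finally show ?thesis
    unfolding gen_op_comp_incr p gr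
    by (simp add: sum.distrib distrib_left inner_add_right)
qed

text \<open>The drift and the compensator obey the Leibniz rule and cancel. Second derivatives leave
  the cross terms, increments leave their product, and killing leaves +\<gamma> f g because
  -\<gamma> f g is subtracted twice from itself.\<close>

lemma carre_gen_op:
  assumes f: "f \<in> C2c" and g: "g \<in> C2c" and sym: "transpose (\<alpha> x) = \<alpha> x"
  shows "carre (gen_op \<alpha> \<beta> \<gamma> \<mu> \<chi>') f g x
    = (\<alpha> x *v grad f x) \<bullet> grad g x + \<gamma> x * f x * g x
      + (\<integral>\<xi>. (f (x + \<xi>) - f x) * (g (x + \<xi>) - g x) \<partial>\<mu> x)"
proof -
  have c: "C2 f" "C2 g" using f g by (auto simp: C2c_iff)
  note d = C2D[OF c(1)] C2D[OF c(2)]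
  have fg: "(\<lambda>y. f y * g y) \<in> C2c" using f c by (rule_tac C2c_mult_C2)
  note ii = comp_incr_integrable[OF se fin chi]
  note gr = grad_mult[OF d(1) d(6), of x]
  have jump: "(\<integral>\<xi>. comp_incr \<chi>' (\<lambda>y. f y * g y) x \<xi> \<partial>\<mu> x) - f x * (\<integral>\<xi>. comp_incr \<chi>' g x \<xi> \<partial>\<mu> x)
      - g x * (\<integral>\<xi>. comp_incr \<chi>' f x \<xi> \<partial>\<mu> x) = (\<integral>\<xi>. (f (x + \<xi>) - f x) * (g (x + \<xi>) - g x) \<partial>\<mu> x)"
  proof -
    have "(\<integral>\<xi>. comp_incr \<chi>' (\<lambda>y. f y * g y) x \<xi> \<partial>\<mu> x) - f x * (\<integral>\<xi>. comp_incr \<chi>' g x \<xi> \<partial>\<mu> x)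
        - g x * (\<integral>\<xi>. comp_incr \<chi>' f x \<xi> \<partial>\<mu> x)
      = (\<integral>\<xi>. comp_incr \<chi>' (\<lambda>y. f y * g y) x \<xi> - f x * comp_incr \<chi>' g x \<xi> - g x * comp_incr \<chi>' f x \<xi> \<partial>\<mu> x)"
      using ii[OF f, of x] ii[OF g, of x] ii[OF fg, of x] by simp
    also have "\<dots> = (\<integral>\<xi>. (f (x + \<xi>) - f x) * (g (x + \<xi>) - g x) \<partial>\<mu> x)"
      by (rule Bochner_Integration.integral_cong) (auto simp: comp_incr_def gr algebra_simps)
    finally show ?thesis .
  qed
  have a: "\<alpha> x $ i $ j = \<alpha> x $ j $ i" for i j using sym by (metis transpose_def vec_lambda_beta)
  have S: "(\<alpha> x *v grad f x) \<bullet> grad g x = (\<Sum>i\<in>UNIV. \<Sum>j\<in>UNIV. \<alpha> x $ i $ j * (pd j f x * pd i g x))"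
    by (simp add: inner_vec_def matrix_vector_mult_def grad_def sum_distrib_right mult.assoc)
  \<comment> \<open>Symmetry of \<alpha> makes the two mixed gradient sums equal, which cancels the
    factor 1/2.\<close>
  have S': "(\<alpha> x *v grad f x) \<bullet> grad g x = (\<Sum>i\<in>UNIV. \<Sum>j\<in>UNIV. \<alpha> x $ i $ j * (pd i f x * pd j g x))"
    unfolding S by (subst sum.swap) (simp add: a)
  have second: "(1/2) * (\<Sum>i\<in>UNIV. \<Sum>j\<in>UNIV. \<alpha> x $ i $ j * pd i (pd j (\<lambda>y. f y * g y)) x)
      = f x * ((1/2) * (\<Sum>i\<in>UNIV. \<Sum>j\<in>UNIV. \<alpha> x $ i $ j * pd i (pd j g) x))
      + g x * ((1/2) * (\<Sum>i\<in>UNIV. \<Sum>j\<in>UNIV. \<alpha> x $ i $ j * pd i (pd j f) x))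
      + (1/2) * ((\<alpha> x *v grad f x) \<bullet> grad g x + (\<alpha> x *v grad f x) \<bullet> grad g x)"
    by (subst S, subst S', unfold pd_pd_mult[OF c])
       (simp add: sum_distrib_left sum.distrib algebra_simps)
  show ?thesis
    unfolding carre_def gen_op_comp_incr second gr jump[symmetric]
    by (simp add: algebra_simps)
qed

text \<open>Division by e^h turns grad H into grad h, the killing term into (1 - e^(-h)) \<gamma> f,
  which leaves e^(-h) \<gamma> as killing rate, and increments of H into the weight minus 1. The
  last is absorbed by \<open>comp_incr_tilt\<close>.\<close>

lemma gen_op_tilt:
  assumes h: "h \<in> C2c" and f: "f \<in> C2c" and sym: "transpose (\<alpha> x) = \<alpha> x"
  shows "gen_op \<alpha> \<beta> \<gamma> \<mu> \<chi>' f x + carre (gen_op \<alpha> \<beta> \<gamma> \<mu> \<chi>') (\<lambda>y. exp (h y) - 1) f x / exp (h x)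
    = gen_op \<alpha>
        (\<lambda>x. \<beta> x + \<alpha> x *v grad h x + (\<integral>\<xi>. (exp (h (x + \<xi>) - h x) - 1) *\<^sub>R \<chi>' \<xi> \<partial>\<mu> x))
        (\<lambda>x. exp (- h x) * \<gamma> x)
        (\<lambda>x. density (\<mu> x) (\<lambda>\<xi>. ennreal (exp (h (x + \<xi>) - h x)))) \<chi>' f x"
proof -
  let ?H = "\<lambda>y. exp (h y) - 1"
  have H: "?H \<in> C2c" by (rule C2c_exp_minus_1[OF h])
  have c: "C2 h" using h by (simp add: C2c_iff)
  have gH: "grad ?H x = exp (h x) *\<^sub>R grad h x"
  proof -
    have "pd i ?H x = exp (h x) * pd i h x" for i
      using pd_add[OF C2D(1)[OF C2_exp[OF c]] C2D(1)[OF C2_const[of "-1"]], of i x]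
      by (simp add: pd_const pd_exp C2D[OF c])
    then show ?thesis by (simp add: vec_eq_iff grad_def)
  qed
  have int: "(\<integral>\<xi>. (?H (x + \<xi>) - ?H x) * (f (x + \<xi>) - f x) \<partial>\<mu> x)
      = exp (h x) * (\<integral>\<xi>. (exp (h (x + \<xi>) - h x) - 1) * (f (x + \<xi>) - f x) \<partial>\<mu> x)"
    by (subst Bochner_Integration.integral_mult_right_zero[symmetric], rule Bochner_Integration.integral_cong)
       (auto simp: exp_diff field_simps)
  have "carre (gen_op \<alpha> \<beta> \<gamma> \<mu> \<chi>') ?H f x / exp (h x)
      = (\<alpha> x *v grad h x) \<bullet> grad f x + (1 - exp (- h x)) * \<gamma> x * f x
        + (\<integral>\<xi>. (exp (h (x + \<xi>) - h x) - 1) * (f (x + \<xi>) - f x) \<partial>\<mu> x)"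
    unfolding carre_gen_op[OF H f sym] gH int
    by (simp add: matrix_vector_mult_scaleR exp_minus field_simps)
  then show ?thesis
    unfolding gen_op_comp_incr using comp_incr_tilt[OF se fin chi h f, of x]
    by (simp add: inner_add_left inner_commute algebra_simps)
qed

end

section \<open>Change of measure\<close>

lemma bounded_extD:
  assumes "bounded (k ` E)"
  obtains K where "\<And>p. p \<in> insert None (Some ` E) \<Longrightarrow> \<bar>extD k p\<bar> \<le> K"
proof -
  obtain K where K: "\<And>x. x \<in> E \<Longrightarrow> \<bar>k x\<bar> \<le> K" using assms by (auto simp: bounded_iff)
  have "\<bar>extD k p\<bar> \<le> max K 0" if "p \<in> insert None (Some ` E)" for p
    using that K by (auto simp: max.coboundedI1)
  then show thesis by (rule that)
qed

text \<open>The generator stays abstract: its structure enters only through the pointwise identity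
  \<open>AB\<close> and the requirement that H and f e^h be test functions.\<close>

lemma exponential_tilting_martingale:
  fixes E :: "(real^'n::finite) set" and h f b :: "real^'n \<Rightarrow> real"
  defines "H \<equiv> \<lambda>x. exp (h x) - 1" and "fG \<equiv> \<lambda>x. f x * exp (h x)"
  assumes E: "closed E" and P_mp: "solves_mp E A P"
    and Q: "prob_space Q" and spQ: "space Q = Omega E" and seQ: "sets Q = sets (FX E)"
    and QD: "\<And>t B. 0 \<le> t \<Longrightarrow> B \<in> FXtplus E t \<Longrightarrow> measure Q B = (\<integral>\<omega>. Dproc A h t \<omega> * indicator B \<omega> \<partial>P)"
    and C2: "H \<in> C2c" "fG \<in> C2c"
    and h: "h \<in> borel_measurable borel" "bounded (range h)"
    and f: "f \<in> borel_measurable borel" "bounded (range f)"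
    and b: "b \<in> borel_measurable (restrict_space borel E)" "bounded (b ` E)"
    and AB: "\<And>x. x \<in> E \<Longrightarrow> exp (h x) * b x = A fG x - f x * A H x"
  shows "is_martingale Q (FXt E)
     (\<lambda>t \<omega>. extD f (\<omega> t) - extD f (\<omega> 0) - (LINT s:{0..t}|lborel. extD b (\<omega> s)))"
proof -
  let ?p = "\<lambda>p. p \<in> insert None (Some ` E)"
  have P: "prob_space P" and spP: "space P = Omega E" and seP: "sets P = sets (FX E)"
    and Ab: "\<And>g. g \<in> C2c \<Longrightarrow> bounded (A g ` E)"
    and Am: "\<And>g. g \<in> C2c \<Longrightarrow> A g \<in> borel_measurable (restrict_space borel E)"
    and MP: "\<And>g. g \<in> C2c \<Longrightarrow> is_martingale P (FXt E)
           (\<lambda>t \<omega>. extD g (\<omega> t) - extD g (\<omega> 0) - set_lebesgue_integral lborel {0..t} (\<lambda>s. extD (A g) (\<omega> s)))"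
    using P_mp unfolding solves_mp_def by auto
  interpret P: prob_space P by (rule P)
  interpret Q: prob_space Q by (rule Q)
  have subP: "subalgebra P (FXt E r)" for r by (rule subalgebra_FXt[OF spP seP])
  have subQ: "subalgebra Q (FXt E r)" for r by (rule subalgebra_FXt[OF spQ seQ])
  have ibP: "integrable P g" if "g \<in> borel_measurable P" "\<And>\<omega>. \<omega> \<in> Omega E \<Longrightarrow> \<bar>g \<omega>\<bar> \<le> K" for g :: "_ \<Rightarrow> real" and K
    using that spP by (intro P.integrable_const_bound[where B=K] AE_I2) auto
  have ibQ: "integrable Q g" if "g \<in> borel_measurable Q" "\<And>\<omega>. \<omega> \<in> Omega E \<Longrightarrow> \<bar>g \<omega>\<bar> \<le> K" for g :: "_ \<Rightarrow> real" and K
    using that spQ by (intro Q.integrable_const_bound[where B=K] AE_I2) auto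

  \<comment> \<open>These take the roles of the same letters in
    \<open>exponential_product_rule\<close>: y is the process, a its drift under \<open>P\<close>, c
    the rate in the exponential.\<close>
  define y where "y = extD fG"
  define a where "a = extD (A fG)"
  define c where "c = extD (\<lambda>x. - A H x / exp (h x))"
  define hh where "hh = extD h"
  define ff where "ff = extD f"
  define bb where "bb = extD b"
  note hE = measurable_restrict_space1[OF h(1), of E]
  note fE = measurable_restrict_space1[OF f(1), of E]
  have hm: "hh \<in> borel_measurable (borel_Delta E)" unfolding hh_def by (rule measurable_extD[OF hE])
  have fm: "ff \<in> borel_measurable (borel_Delta E)" unfolding ff_def by (rule measurable_extD[OF fE])
  have bm: "bb \<in> borel_measurable (borel_Delta E)" unfolding bb_def by (rule measurable_extD[OF b(1)])
  have am: "a \<in> borel_measurable (borel_Delta E)" unfolding a_def by (rule measurable_extD[OF Am[OF C2(2)]])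
  have ym: "y \<in> borel_measurable (borel_Delta E)"
    unfolding y_def fG_def by (rule measurable_extD) (use hE fE in measurable)
  have cm: "c \<in> borel_measurable (borel_Delta E)"
    unfolding c_def by (rule measurable_extD) (use hE Am[OF C2(1)] in measurable)
  obtain Kh where Kh: "\<And>p. ?p p \<Longrightarrow> \<bar>hh p\<bar> \<le> Kh"
    using bounded_extD[of h E] bounded_subset[OF h(2)] unfolding hh_def by blast
  obtain Kf where Kf: "\<And>p. ?p p \<Longrightarrow> \<bar>ff p\<bar> \<le> Kf"
    using bounded_extD[of f E] bounded_subset[OF f(2)] unfolding ff_def by blast
  obtain Kb where Kb: "\<And>p. ?p p \<Longrightarrow> \<bar>bb p\<bar> \<le> Kb"
    using bounded_extD[OF b(2)] unfolding bb_def by blast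
  obtain Ka where Ka: "\<And>p. ?p p \<Longrightarrow> \<bar>a p\<bar> \<le> Ka"
    using bounded_extD[OF Ab[OF C2(2)]] unfolding a_def by blast
  obtain KH where KH: "\<And>p. ?p p \<Longrightarrow> \<bar>extD (A H) p\<bar> \<le> KH"
    using bounded_extD[OF Ab[OF C2(1)]] by blast
  have expb: "\<bar>exp z\<bar> \<le> exp K" if "\<bar>z\<bar> \<le> K" for z K :: real using that by auto
  have yeq: "y p = ff p * exp (hh p)" for p
    by (cases p) (auto simp: y_def ff_def hh_def fG_def)
  have ceq: "c p = - extD (A H) p * exp (- hh p)" for p
    by (cases p) (auto simp: c_def hh_def exp_minus field_simps)
  have Ky: "\<bar>y p\<bar> \<le> Kf * exp Kh" if "?p p" for p
    unfolding yeq by (intro abs_mult_le Kf expb Kh that)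
  have Kc: "\<bar>c p\<bar> \<le> KH * exp Kh" if "?p p" for p
    unfolding ceq by (intro abs_mult_le expb) (use KH[OF that] Kh[OF that] in auto)
  \<comment> \<open>On E the term c y is -f A H, so this is \<open>AB\<close>; at the cemetery every
    term vanishes by the extension by 0.\<close>
  have key: "exp (hh p) * bb p = a p + c p * y p" if "?p p" for p
    using that by (auto simp: hh_def bb_def a_def c_def y_def AB) (simp add: fG_def)

  define \<epsilon> where "\<epsilon> r \<omega> = exp (LINT x:{0..r}|lborel. c (\<omega> x))" for r :: real and \<omega> :: "real \<Rightarrow> (real^'n) option"
  have Deq: "Dproc A h r \<omega> = exp (hh (\<omega> r)) * exp (- hh (\<omega> 0)) * \<epsilon> r \<omega>" for r \<omega>
  proof -
    have "(\<lambda>s. c (\<omega> s)) = (\<lambda>s. - extD (\<lambda>x. A H x / exp (h x)) (\<omega> s))"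
      unfolding c_def by (rule ext) (simp add: extD_def split: option.split)
    then have "(LINT x:{0..r}|lborel. c (\<omega> x))
        = - (LINT x:{0..r}|lborel. extD (\<lambda>x. A H x / exp (h x)) (\<omega> x))"
      by (simp add: set_lebesgue_integral_def)
    then show ?thesis
      unfolding Dproc_def \<epsilon>_def hh_def H_def by (simp add: exp_diff exp_minus divide_inverse)
  qed
  have \<epsilon>m: "\<epsilon> r \<in> borel_measurable (FXt E r)" for r
    using path_integral_measurable[OF E cm Kc order_refl, of r] unfolding \<epsilon>_def[abs_def] by measurable
  have Dm: "Dproc A h r \<in> borel_measurable (FXt E r)" if r: "0 \<le> r" for r
    unfolding Deq[abs_def] using \<epsilon>m[of r] measurable_coordinate_compose[OF r order_refl hm] measurable_coordinate_compose[OF order_refl r hm] by measurable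
  have Di: "integrable P (Dproc A h r)" if r: "0 \<le> r" for r
  proof (rule ibP)
    show "Dproc A h r \<in> borel_measurable P" by (rule measurable_from_subalg[OF subP Dm[OF r]])
    fix \<omega> assume w: "\<omega> \<in> Omega E"
    show "\<bar>Dproc A h r \<omega>\<bar> \<le> exp Kh * exp Kh * exp (KH * exp Kh * (r - 0))"
      unfolding Deq \<epsilon>_def
      by (intro abs_mult_le expb path_integral_bound[OF E cm Kc w r])
         (use Kh Omega_range[OF w] in auto)
  qed
  \<comment> \<open>Each expectation is moved with the density at its own time. That one measure
    \<open>Q\<close> serves all times makes the densities consistent.\<close>
  have com: "(\<integral>\<omega>. F \<omega> \<partial>Q) = (\<integral>\<omega>. Dproc A h r \<omega> * F \<omega> \<partial>P)"
    if r: "0 \<le> r" and F: "F \<in> borel_measurable (FXt E r)" for r and F :: "_ \<Rightarrow> real"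
  proof (rule integral_change_of_measure[OF P Q subP subQ Dm[OF r] Di[OF r] _ _ F])
    show "0 \<le> Dproc A h r \<omega>" for \<omega> unfolding Dproc_def by simp
    show "measure Q B = (\<integral>\<omega>. Dproc A h r \<omega> * indicator B \<omega> \<partial>P)" if "B \<in> sets (FXt E r)" for B
      using QD[OF r] that sets_FXt_subset_plus by blast
  qed

  \<comment> \<open>The martingale problem for f e^h, recast as the test-variable hypothesis of the
    product rule.\<close>
  have mart: "(\<integral>\<omega>. Z \<omega> * (y (\<omega> v) - y (\<omega> u)) \<partial>P) = (\<integral>\<omega>. Z \<omega> * (LINT r:{u..v}|lborel. a (\<omega> r)) \<partial>P)"
    if uv: "0 \<le> u" "u \<le> v" and Z: "Z \<in> borel_measurable (FXt E u)"
      and B: "\<And>\<omega>. \<omega> \<in> Omega E \<Longrightarrow> \<bar>Z \<omega>\<bar> \<le> B" for u v Z B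
  proof -
    let ?M = "\<lambda>t \<omega>. extD fG (\<omega> t) - extD fG (\<omega> 0) - set_lebesgue_integral lborel {0..t} (\<lambda>s. extD (A fG) (\<omega> s))"
    have v0: "0 \<le> v" using uv by simp
    have ZP [measurable]: "Z \<in> borel_measurable P" by (rule measurable_from_subalg[OF subP Z])
    have yP [measurable]: "(\<lambda>\<omega>. y (\<omega> r)) \<in> borel_measurable P" if "0 \<le> r" for r
      using measurable_from_subalg[OF subP measurable_coordinate_compose[OF that order_refl ym]] .
    have IP [measurable]: "(\<lambda>\<omega>. LINT r:{u..v}|lborel. a (\<omega> r)) \<in> borel_measurable P" if "0 \<le> u" for u v
      using measurable_from_subalg[OF subP path_integral_measurable[OF E am Ka that]] .
    have iM: "integrable P (?M r)" if "0 \<le> r" for r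
      using MP[OF C2(2)] that unfolding is_martingale_def by blast
    have iZM: "integrable P (\<lambda>\<omega>. Z \<omega> * ?M r \<omega>)" if "0 \<le> r" for r
    proof (rule Bochner_Integration.integrable_bound)
      show "integrable P (\<lambda>\<omega>. B * ?M r \<omega>)" using iM[OF that] by (rule integrable_mult_right)
      show "(\<lambda>\<omega>. Z \<omega> * ?M r \<omega>) \<in> borel_measurable P"
        using borel_measurable_integrable[OF iM[OF that]] by measurable
      show "AE \<omega> in P. norm (Z \<omega> * ?M r \<omega>) \<le> norm (B * ?M r \<omega>)"
        unfolding real_norm_def abs_mult
        by (intro AE_I2 mult_right_mono order_trans[OF B abs_ge_self]) (auto simp: spP)
    qed
    have yv: "\<bar>y (\<omega> r)\<bar> \<le> Kf * exp Kh" if "\<omega> \<in> Omega E" for \<omega> r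
      by (rule Ky[OF Omega_range[OF that]])
    have 1: "integrable P (\<lambda>\<omega>. Z \<omega> * (y (\<omega> v) - y (\<omega> u)))"
    proof (rule ibP)
      show "(\<lambda>\<omega>. Z \<omega> * (y (\<omega> v) - y (\<omega> u))) \<in> borel_measurable P" using uv v0 by measurable
      show "\<bar>Z \<omega> * (y (\<omega> v) - y (\<omega> u))\<bar> \<le> B * (Kf * exp Kh + Kf * exp Kh)" if "\<omega> \<in> Omega E" for \<omega>
        using yv[OF that, of u] yv[OF that, of v] by (intro abs_mult_le B that) linarith
    qed
    have 2: "integrable P (\<lambda>\<omega>. Z \<omega> * (LINT r:{u..v}|lborel. a (\<omega> r)))"
    proof (rule ibP)
      show "(\<lambda>\<omega>. Z \<omega> * (LINT r:{u..v}|lborel. a (\<omega> r))) \<in> borel_measurable P" using uv by measurable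
      show "\<bar>Z \<omega> * (LINT r:{u..v}|lborel. a (\<omega> r))\<bar> \<le> B * (Ka * (v - u))" if "\<omega> \<in> Omega E" for \<omega>
        by (intro abs_mult_le B that path_integral_bound[OF E am Ka that uv(2)])
    qed
    have "0 = (\<integral>\<omega>. Z \<omega> * ?M v \<omega> \<partial>P) - (\<integral>\<omega>. Z \<omega> * ?M u \<omega> \<partial>P)"
      using martingale_orthogonal[OF P subP MP[OF C2(2)] uv Z, of B] B spP by simp
    also have "\<dots> = (\<integral>\<omega>. Z \<omega> * ?M v \<omega> - Z \<omega> * ?M u \<omega> \<partial>P)"
      by (rule Bochner_Integration.integral_diff[symmetric]) (use iZM uv v0 in auto)
    also have "\<dots> = (\<integral>\<omega>. Z \<omega> * (y (\<omega> v) - y (\<omega> u)) - Z \<omega> * (LINT r:{u..v}|lborel. a (\<omega> r)) \<partial>P)"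
    proof (rule Bochner_Integration.integral_cong[OF refl])
      fix \<omega> assume "\<omega> \<in> space P"
      then have w: "\<omega> \<in> Omega E" using spP by simp
      have "(LINT r:{0..v}|lborel. a (\<omega> r)) = (LINT r:{0..u}|lborel. a (\<omega> r)) + (LINT r:{u..v}|lborel. a (\<omega> r))"
        by (rule set_integral_combine[OF path_set_integrable[OF E am Ka w order_refl] uv])
      then show "Z \<omega> * ?M v \<omega> - Z \<omega> * ?M u \<omega>
          = Z \<omega> * (y (\<omega> v) - y (\<omega> u)) - Z \<omega> * (LINT r:{u..v}|lborel. a (\<omega> r))"
        by (simp add: y_def a_def algebra_simps)
    qed
    also have "\<dots> = (\<integral>\<omega>. Z \<omega> * (y (\<omega> v) - y (\<omega> u)) \<partial>P) - (\<integral>\<omega>. Z \<omega> * (LINT r:{u..v}|lborel. a (\<omega> r)) \<partial>P)"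
      by (rule Bochner_Integration.integral_diff[OF 1 2])
    finally show ?thesis by simp
  qed

  let ?N = "\<lambda>t \<omega>. ff (\<omega> t) - ff (\<omega> 0) - (LINT s:{0..t}|lborel. bb (\<omega> s))"
  have Nm: "?N t \<in> borel_measurable (FXt E t)" if t: "0 \<le> t" for t
    using measurable_coordinate_compose[OF t order_refl fm] measurable_coordinate_compose[OF order_refl t fm] path_integral_measurable[OF E bm Kb order_refl, of t]
    by measurable
  have NQ: "?N t \<in> borel_measurable Q" if t: "0 \<le> t" for t
    by (rule measurable_from_subalg[OF subQ Nm[OF t]])
  have Nb: "\<bar>?N t \<omega>\<bar> \<le> Kf + Kf + Kb * (t - 0)" if "0 \<le> t" "\<omega> \<in> Omega E" for t \<omega>
    using Kf[OF Omega_range[OF that(2)], of t] Kf[OF Omega_range[OF that(2)], of 0]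
      path_integral_bound[OF E bm Kb that(2,1)] by linarith
  have Ni: "integrable Q (?N t)" if "0 \<le> t" for t
    by (rule ibQ[OF NQ[OF that] Nb[OF that]])
  have main: "set_lebesgue_integral Q S (?N t) = set_lebesgue_integral Q S (?N s)"
    if st: "0 \<le> s" "s \<le> t" and S: "S \<in> sets (FXt E s)" for s t S
  proof -
    have t0: "0 \<le> t" using st by simp
    have Sm: "indicat_real S \<in> borel_measurable (FXt E r)" if "s \<le> r" for r
      using S sets_FXt_mono[OF that, of E] by (intro borel_measurable_indicator) auto
    have SQ [measurable]: "indicat_real S \<in> borel_measurable Q"
      by (rule measurable_from_subalg[OF subQ Sm[OF order_refl]])
    have I1: "\<bar>indicat_real S \<omega>\<bar> \<le> 1" for \<omega> by (simp add: indicator_def)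
    \<comment> \<open>The normalisation e^(-h(X_0)) in the density is known at time s, like S, so
      both go into the test variable.\<close>
    define Z0 where "Z0 \<omega> = indicat_real S \<omega> * exp (- hh (\<omega> 0))" for \<omega>
    have Z0m: "Z0 \<in> borel_measurable (FXt E s)"
      unfolding Z0_def[abs_def] using Sm[OF order_refl] measurable_coordinate_compose[OF order_refl st(1) hm] by measurable
    have Z0b: "\<bar>Z0 \<omega>\<bar> \<le> 1 * exp Kh" if "\<omega> \<in> Omega E" for \<omega>
      unfolding Z0_def by (intro abs_mult_le I1 expb) (use Kh[OF Omega_range[OF that]] in simp)
    have Qf: "(\<integral>\<omega>. indicat_real S \<omega> * ff (\<omega> r) \<partial>Q) = (\<integral>\<omega>. Z0 \<omega> * \<epsilon> r \<omega> * y (\<omega> r) \<partial>P)"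
      if r: "s \<le> r" for r
    proof -
      have r0: "0 \<le> r" using r st by simp
      have "(\<lambda>\<omega>. indicat_real S \<omega> * ff (\<omega> r)) \<in> borel_measurable (FXt E r)"
        using Sm[OF r] measurable_coordinate_compose[OF r0 order_refl fm] by measurable
      from com[OF r0 this] show ?thesis
        by (simp add: Deq Z0_def yeq mult_ac)
    qed
    define \<psi> where "\<psi> r = (\<integral>\<omega>. Z0 \<omega> * \<epsilon> r \<omega> * (a (\<omega> r) + c (\<omega> r) * y (\<omega> r)) \<partial>P)" for r
    \<comment> \<open>The factor e^(h(X_r)) of the density multiplies \<open>bb\<close>; by
      \<open>key\<close> this is the drift given by the product rule.\<close>
    have Qb: "(\<integral>\<omega>. indicat_real S \<omega> * bb (\<omega> r) \<partial>Q) = \<psi> r" if r: "s \<le> r" for r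
    proof -
      have r0: "0 \<le> r" using r st by simp
      have "(\<lambda>\<omega>. indicat_real S \<omega> * bb (\<omega> r)) \<in> borel_measurable (FXt E r)"
        using Sm[OF r] measurable_coordinate_compose[OF r0 order_refl bm] by measurable
      from com[OF r0 this] have "(\<integral>\<omega>. indicat_real S \<omega> * bb (\<omega> r) \<partial>Q)
          = (\<integral>\<omega>. Dproc A h r \<omega> * (indicat_real S \<omega> * bb (\<omega> r)) \<partial>P)" .
      also have "\<dots> = \<psi> r" unfolding \<psi>_def
      proof (rule Bochner_Integration.integral_cong[OF refl])
        fix \<omega> assume "\<omega> \<in> space P"
        then have "?p (\<omega> r)" using spP Omega_range by blast
        from key[OF this, symmetric]
        show "Dproc A h r \<omega> * (indicat_real S \<omega> * bb (\<omega> r)) = Z0 \<omega> * \<epsilon> r \<omega> * (a (\<omega> r) + c (\<omega> r) * y (\<omega> r))"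
          by (simp add: Deq Z0_def mult_ac)
      qed
      finally show ?thesis .
    qed
    note FubQ = path_Fubini[OF E bm Kb Q spQ seQ SQ I1 st(1), of t]
    have \<psi>eq: "(LINT r:{s..t}|lborel. (\<integral>\<omega>. indicat_real S \<omega> * bb (\<omega> r) \<partial>Q)) = (LINT r:{s..t}|lborel. \<psi> r)"
      by (rule set_lebesgue_integral_cong) (auto simp: Qb)
    \<comment> \<open>Under \<open>P\<close> the integrand contains \<epsilon> at the varying time
      r, beyond the reach of \<open>path_Fubini\<close>. Under \<open>Q\<close> it is a fixed
      indicator times a function of the state at time r.\<close>
    have \<psi>i: "set_integrable lborel {s..t} \<psi>"
      using FubQ(2) by (rule set_integrable_cong[THEN iffD1, rotated -1]) (auto simp: Qb)
    have "(\<integral>\<omega>. Z0 \<omega> * \<epsilon> t \<omega> * y (\<omega> t) \<partial>P) = (\<integral>\<omega>. Z0 \<omega> * \<epsilon> s \<omega> * y (\<omega> s) \<partial>P) + (LINT r:{s..t}|lborel. \<psi> r)"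
      unfolding \<psi>_def \<epsilon>_def
    proof (rule exponential_product_rule[OF E P spP seP ym _ am _ cm _ _ st Z0m Z0b])
      show "set_integrable lborel {s..t} (\<lambda>r. \<integral>\<omega>. Z0 \<omega> * exp (LINT x:{0..r}|lborel. c (\<omega> x))
          * (a (\<omega> r) + c (\<omega> r) * y (\<omega> r)) \<partial>P)"
        using \<psi>i unfolding \<psi>_def[abs_def] \<epsilon>_def .
    qed (fact Ky Ka Kc mart)+
    then have core: "(\<integral>\<omega>. indicat_real S \<omega> * ff (\<omega> t) \<partial>Q) = (\<integral>\<omega>. indicat_real S \<omega> * ff (\<omega> s) \<partial>Q)
        + (\<integral>\<omega>. indicat_real S \<omega> * (LINT r:{s..t}|lborel. bb (\<omega> r)) \<partial>Q)"
      using Qf[OF st(2)] Qf[OF order_refl] FubQ(1) \<psi>eq by simp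
    have iS: "integrable Q (\<lambda>\<omega>. indicat_real S \<omega> * ff (\<omega> r))" if "0 \<le> r" for r
    proof (rule ibQ)
      show "(\<lambda>\<omega>. indicat_real S \<omega> * ff (\<omega> r)) \<in> borel_measurable Q"
        using measurable_from_subalg[OF subQ measurable_coordinate_compose[OF that order_refl fm]] by measurable
      show "\<bar>indicat_real S \<omega> * ff (\<omega> r)\<bar> \<le> 1 * Kf" if "\<omega> \<in> Omega E" for \<omega>
        by (intro abs_mult_le I1 Kf Omega_range that)
    qed
    have iL: "integrable Q (\<lambda>\<omega>. indicat_real S \<omega> * (LINT r:{u..v}|lborel. bb (\<omega> r)))" if "0 \<le> u" "u \<le> v" for u v
    proof (rule ibQ)
      show "(\<lambda>\<omega>. indicat_real S \<omega> * (LINT r:{u..v}|lborel. bb (\<omega> r))) \<in> borel_measurable Q"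
        using measurable_from_subalg[OF subQ path_integral_measurable[OF E bm Kb that(1)]] by measurable
      show "\<bar>indicat_real S \<omega> * (LINT r:{u..v}|lborel. bb (\<omega> r))\<bar> \<le> 1 * (Kb * (v - u))" if "\<omega> \<in> Omega E" for \<omega>
        by (intro abs_mult_le I1 path_integral_bound[OF E bm Kb] that \<open>u \<le> v\<close>)
    qed
    have exp: "set_lebesgue_integral Q S (?N r) = (\<integral>\<omega>. indicat_real S \<omega> * ff (\<omega> r) \<partial>Q)
        - (\<integral>\<omega>. indicat_real S \<omega> * ff (\<omega> 0) \<partial>Q) - (\<integral>\<omega>. indicat_real S \<omega> * (LINT x:{0..r}|lborel. bb (\<omega> x)) \<partial>Q)"
      if "0 \<le> r" for r
      unfolding set_lebesgue_integral_def[of Q]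
      using iS[OF that] iS[OF order_refl] iL[OF order_refl that]
      by (simp add: right_diff_distrib)
    have "(\<integral>\<omega>. indicat_real S \<omega> * (LINT x:{0..t}|lborel. bb (\<omega> x)) \<partial>Q)
        = (\<integral>\<omega>. indicat_real S \<omega> * (LINT x:{0..s}|lborel. bb (\<omega> x)) + indicat_real S \<omega> * (LINT x:{s..t}|lborel. bb (\<omega> x)) \<partial>Q)"
    proof (rule Bochner_Integration.integral_cong[OF refl])
      fix \<omega> assume "\<omega> \<in> space Q"
      then have w: "\<omega> \<in> Omega E" using spQ by simp
      show "indicat_real S \<omega> * (LINT x:{0..t}|lborel. bb (\<omega> x))
        = indicat_real S \<omega> * (LINT x:{0..s}|lborel. bb (\<omega> x)) + indicat_real S \<omega> * (LINT x:{s..t}|lborel. bb (\<omega> x))"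
        using set_integral_combine[OF path_set_integrable[OF E bm Kb w order_refl] st]
        by (simp add: distrib_left)
    qed
    also have "\<dots> = (\<integral>\<omega>. indicat_real S \<omega> * (LINT x:{0..s}|lborel. bb (\<omega> x)) \<partial>Q)
        + (\<integral>\<omega>. indicat_real S \<omega> * (LINT x:{s..t}|lborel. bb (\<omega> x)) \<partial>Q)"
      by (rule Bochner_Integration.integral_add[OF iL[OF order_refl st(1)] iL[OF st]])
    finally show ?thesis unfolding exp[OF st(1)] exp[OF t0] using core by simp
  qed
  have "is_martingale Q (FXt E) ?N"
    unfolding is_martingale_def using Ni Nm main by blast
  then show ?thesis unfolding ff_def bb_def .
qed

theorem theorem5p1:
  fixes E :: "(real^'n::finite) set"
    and \<alpha> :: "real^'n \<Rightarrow> real^'n^'n" and \<beta> :: "real^'n \<Rightarrow> real^'n" and \<gamma> :: "real^'n \<Rightarrow> real"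
    and \<mu> :: "real^'n \<Rightarrow> (real^'n) measure" and \<chi>' :: "real^'n \<Rightarrow> real^'n"
    and h :: "real^'n \<Rightarrow> real"
    and P Q :: "(real \<Rightarrow> (real^'n) option) measure"
  assumes E_closed: "closed E"
    and chi_cont: "continuous_on UNIV \<chi>'" and chi_bdd: "bounded (range \<chi>')"
    and chi_id: "\<exists>\<epsilon>>0. \<forall>\<xi>. norm \<xi> < \<epsilon> \<longrightarrow> \<chi>' \<xi> = \<xi>"
    and alpha_psd: "\<forall>x\<in>E. transpose (\<alpha> x) = \<alpha> x \<and> (\<forall>v. 0 \<le> v \<bullet> (\<alpha> x *v v))"
    and gamma_nonneg: "\<forall>x\<in>E. 0 \<le> \<gamma> x"
    and alpha_meas: "\<alpha> \<in> borel_measurable (restrict_space borel E)"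
    and beta_meas: "\<beta> \<in> borel_measurable (restrict_space borel E)"
    and gamma_meas: "\<gamma> \<in> borel_measurable (restrict_space borel E)"
    and mu_sets: "\<forall>x\<in>E. sets (\<mu> x) = sets borel"
    and mu_kernel: "\<forall>B\<in>sets borel. (\<lambda>x. emeasure (\<mu> x) B) \<in> borel_measurable (restrict_space borel E)"
    and loc_bdd: "\<forall>K. compact K \<and> K \<subseteq> E \<longrightarrow>
        bounded (\<alpha> ` K) \<and> bounded (\<beta> ` K) \<and> bounded (\<gamma> ` K)
        \<and> (\<exists>C::real. \<forall>x\<in>K. (\<integral>\<^sup>+\<xi>. ennreal (min ((norm \<xi>)\<^sup>2) 1) \<partial>\<mu> x) \<le> ennreal C)"
    and P_mp: "solves_mp E (gen_op \<alpha> \<beta> \<gamma> \<mu> \<chi>') P"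
    and h_C2c: "h \<in> C2c"
    and Q_prob: "prob_space Q" and Q_space: "space Q = Omega E" and Q_sets: "sets Q = sets (FX E)"
    and Q_def: "\<forall>t\<ge>0. \<forall>A\<in>FXtplus E t.
        measure Q A = (\<integral>\<omega>. Dproc (gen_op \<alpha> \<beta> \<gamma> \<mu> \<chi>') h t \<omega> * indicator A \<omega> \<partial>P)"
  shows "solves_mp E
           (\<lambda>f x. gen_op \<alpha> \<beta> \<gamma> \<mu> \<chi>' f x
                  + carre (gen_op \<alpha> \<beta> \<gamma> \<mu> \<chi>') (\<lambda>y. exp (h y) - 1) f x / exp (h x)) Q
       \<and> (\<forall>f\<in>C2c. \<forall>x\<in>E.
            gen_op \<alpha> \<beta> \<gamma> \<mu> \<chi>' f x
              + carre (gen_op \<alpha> \<beta> \<gamma> \<mu> \<chi>') (\<lambda>y. exp (h y) - 1) f x / exp (h x)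
            = gen_op \<alpha>
                (\<lambda>x. \<beta> x + \<alpha> x *v grad h x
                      + (\<integral>\<xi>. (exp (h (x + \<xi>) - h x) - 1) *\<^sub>R \<chi>' \<xi> \<partial>\<mu> x))
                (\<lambda>x. exp (- h x) * \<gamma> x)
                (\<lambda>x. density (\<mu> x) (\<lambda>\<xi>. ennreal (exp (h (x + \<xi>) - h x))))
                \<chi>' f x)"
proof -
  let ?A = "gen_op \<alpha> \<beta> \<gamma> \<mu> \<chi>'" and ?H = "\<lambda>y. exp (h y) - 1"
  let ?b = "\<lambda>f x. ?A f x + carre ?A ?H f x / exp (h x)"
  have H: "?H \<in> C2c" by (rule C2c_exp_minus_1[OF h_C2c])
  have c2h: "C2 h" using h_C2c by (simp add: C2c_iff)
  \<comment> \<open>Singletons are compact, so the local bound gives a finite Levy integral at each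
    state.\<close>
  have fin: "\<exists>C. (\<integral>\<^sup>+\<xi>. ennreal (min ((norm \<xi>)\<^sup>2) 1) \<partial>\<mu> x) \<le> ennreal C" if "x \<in> E" for x
    using loc_bdd[rule_format, of "{x}"] that by auto
  have Ab: "bounded (?A g ` E)" and Am: "?A g \<in> borel_measurable (restrict_space borel E)" if "g \<in> C2c" for g
    using P_mp that unfolding solves_mp_def by auto
  obtain Kh where Kh: "\<And>x. \<bar>h x\<bar> \<le> Kh" using C2c_bounds[OF h_C2c] by metis
  have hm: "h \<in> borel_measurable borel" by (rule C2c_borel[OF h_C2c])
  have main: "bounded (?b f ` E) \<and> ?b f \<in> borel_measurable (restrict_space borel E)
      \<and> is_martingale Q (FXt E)
         (\<lambda>t \<omega>. extD f (\<omega> t) - extD f (\<omega> 0) - set_lebesgue_integral lborel {0..t} (\<lambda>s. extD (?b f) (\<omega> s)))"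
    if f: "f \<in> C2c" for f
  proof -
    let ?fG = "\<lambda>x. f x * exp (h x)" and ?Hf = "\<lambda>y. ?H y * f y"
    have c2f: "C2 f" using f by (simp add: C2c_iff)
    have fG: "?fG \<in> C2c" by (rule C2c_mult_C2[OF f C2_exp[OF c2h]])
    have Hf: "?Hf \<in> C2c" by (rule C2c_mult_C2[OF H c2f])
    have fm: "f \<in> borel_measurable borel" by (rule C2c_borel[OF f])
    obtain Kf where Kf: "\<And>x. \<bar>f x\<bar> \<le> Kf" using C2c_bounds[OF f] by metis
    have split: "?A ?fG x = ?A f x + ?A ?Hf x" if x: "x \<in> E" for x
    proof -
      obtain C where C: "(\<integral>\<^sup>+\<xi>. ennreal (min ((norm \<xi>)\<^sup>2) 1) \<partial>\<mu> x) \<le> ennreal C" using fin[OF x] by blast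
      have "?fG = (\<lambda>y. f y + ?Hf y)" by (rule ext) (simp add: algebra_simps)
      then show ?thesis
        using gen_op_add[where \<mu>=\<mu> and x=x, OF mu_sets[rule_format, OF x] C chi_cont chi_bdd chi_id f Hf] by simp
    qed
    \<comment> \<open>Multiplying by e^h = 1 + H, the term H A f cancels against the one in the
      carre-du-champ; what remains is A f + A(H f) - f A H.\<close>
    have AB: "exp (h x) * ?b f x = ?A ?fG x - f x * ?A ?H x" if "x \<in> E" for x
      unfolding split[OF that] carre_def by (simp add: field_simps)
    have "?b f \<in> borel_measurable (restrict_space borel E)"
      unfolding carre_def[abs_def]
      using Am[OF f] Am[OF H] Am[OF Hf] measurable_restrict_space1[OF fm, of E] measurable_restrict_space1[OF hm, of E]
      by measurable
    moreover have "bounded (?b f ` E)"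
    proof -
      obtain K1 where K1: "\<And>x. x \<in> E \<Longrightarrow> \<bar>?A ?fG x\<bar> \<le> K1" using Ab[OF fG] by (auto simp: bounded_iff)
      obtain K2 where K2: "\<And>x. x \<in> E \<Longrightarrow> \<bar>?A ?H x\<bar> \<le> K2" using Ab[OF H] by (auto simp: bounded_iff)
      have "\<bar>?b f x\<bar> \<le> exp Kh * (K1 + Kf * K2)" if x: "x \<in> E" for x
      proof -
        \<comment> \<open>Coefficients are bounded only locally. A global bound comes from the
          boundedness of A on test functions contained in \<open>solves_mp\<close> for
          \<open>P\<close>, once the new operator is expressed through f e^h and H.\<close>
        have eq: "?b f x = exp (- h x) * (?A ?fG x - f x * ?A ?H x)"
          unfolding AB[OF x, symmetric] by (simp add: exp_minus)
        have 1: "\<bar>?A ?fG x - f x * ?A ?H x\<bar> \<le> K1 + Kf * K2"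
          using K1[OF x] abs_mult_le[OF Kf[of x] K2[OF x]] by linarith
        have 2: "\<bar>exp (- h x)\<bar> \<le> exp Kh" using Kh[of x] by auto
        show ?thesis unfolding eq by (rule abs_mult_le[OF 2 1])
      qed
      then show ?thesis by (auto simp: bounded_iff)
    qed
    moreover have "is_martingale Q (FXt E)
       (\<lambda>t \<omega>. extD f (\<omega> t) - extD f (\<omega> 0) - set_lebesgue_integral lborel {0..t} (\<lambda>s. extD (?b f) (\<omega> s)))"
    proof (rule exponential_tilting_martingale[OF E_closed P_mp Q_prob Q_space Q_sets _ H fG hm _ fm])
      show "measure Q B = (\<integral>\<omega>. Dproc ?A h t \<omega> * indicator B \<omega> \<partial>P)" if "0 \<le> t" "B \<in> FXtplus E t" for t B
        using Q_def that by blast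
      show "bounded (range h)" "bounded (range f)" using Kh Kf by (auto simp: bounded_iff)
    qed (use calculation AB in auto)
    ultimately show ?thesis by blast
  qed
  have "?b f x = gen_op \<alpha>
                (\<lambda>x. \<beta> x + \<alpha> x *v grad h x
                      + (\<integral>\<xi>. (exp (h (x + \<xi>) - h x) - 1) *\<^sub>R \<chi>' \<xi> \<partial>\<mu> x))
                (\<lambda>x. exp (- h x) * \<gamma> x)
                (\<lambda>x. density (\<mu> x) (\<lambda>\<xi>. ennreal (exp (h (x + \<xi>) - h x))))
                \<chi>' f x" if f: "f \<in> C2c" and x: "x \<in> E" for f x
  proof -
    obtain C where C: "(\<integral>\<^sup>+\<xi>. ennreal (min ((norm \<xi>)\<^sup>2) 1) \<partial>\<mu> x) \<le> ennreal C" using fin[OF x] by blast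
    show ?thesis
      by (rule gen_op_tilt[where \<mu>=\<mu> and x=x, OF mu_sets[rule_format, OF x] C chi_cont chi_bdd chi_id h_C2c f])
         (use alpha_psd x in auto)
  qed
  moreover have "solves_mp E ?b Q"
    unfolding solves_mp_def using Q_prob Q_space Q_sets main by blast
  ultimately show ?thesis by blast
qed

end
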